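(* If $s\in\{1,\dots,p\}$ and $R\in\{1,\dots,p\}$ divides $p$, then $$\varepsilon^*(p,s,1,R)^2\asymp\begin{cases}0&\text{if }s<\frac{p}{R},\\ s\log\left(1+\frac{p^2}{Rs^2}\right)&\text{if }\frac{p}{R}\leq s<\frac{p}{\sqrt{R}},\\ \frac{p}{\sqrt{R}}&\text{if }\frac{p}{\sqrt{R}}\leq s\leq p.\end{cases}$$
   Context: Notation: $\|\cdot\|$ is the Euclidean norm; $\|\theta\|_0$ is the number of nonzero coordinates. Let $R$ divide $p$ and let $B_1,\dots,B_R$ be a partition of $[p]=\{1,\dots,p\}$ into $R$ known groups of size $p/R$ each. $\mathbf{1}_{B_k}\in\mathbb{R}^p$ is the indicator vector of $B_k$. For $\theta\in\mathbb{R}^p$ and $\gamma\in[0,1]$, $P_{\theta,\gamma,R}$ denotes the (possibly degenerate) distribution $N\big(\theta,(1-\gamma)I_p+\gamma\sum_{k=1}^R\mathbf{1}_{B_k}\mathbf{1}_{B_k}^\intercal\big)$ of the observation $X$; the theorem concerns $\gamma=1$. For $\varepsilon>0$ let $\Theta(p,s,\varepsilon)=\{\theta\in\mathbb{R}^p:\|\theta\|\geq\varepsilon,\ \|\theta\|_0\leq s\}$. The minimax testing risk for $H_0:\theta=0$ against $H_1:\theta\in\Theta(p,s,\varepsilon)$ is $$\mathcal{R}(\varepsilon)=\inf_{\varphi}\Big\{P_{0,\gamma,R}\{\varphi=1\}+\sup_{\theta\in\Theta(p,s,\varepsilon)}P_{\theta,\gamma,R}\{\varphi=0\}\Big\},$$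 the infimum being over all measurable $\varphi:\mathbb{R}^p\to\{0,1\}$ (this does not depend on the choice of the groups, only on $R$). Definition: $\varepsilon^*=\varepsilon^*(p,s,\gamma,R)$ is the minimax separation rate if (i) for every $\eta\in(0,1)$ there is $C_\eta>0$ depending only on $\eta$ such that $C>C_\eta$ implies $\mathcal{R}(C\varepsilon^* )\leq\eta$; and (ii) for every $\eta\in(0,1)$ there is $c_\eta>0$ depending only on $\eta$ such that $0<c<c_\eta$ implies $\mathcal{R}(c\varepsilon^* )\geq1-\eta$. The constants do not depend on $(p,s,\gamma,R)$. The rate is unique only up to multiplication by universal constants, and $a\asymp b$ means equality up to universal positive multiplicative constants; thus $(\varepsilon^* )^2\asymp\psi^2$ means that $\psi$ satisfies (i) and (ii) in place of $\varepsilon^*$. Convention for a degenerate rate: that the rate equals $0$ means $\mathcal{R}(\varepsilon)=0$ for every $\varepsilon>0$. *)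

theory Defs
  imports "HOL-Probability.Probability"
begin

text \<open>
  Since the constants in the separation rate are uniform in the dimension, \<open>\<real>\<^sup>p\<close> is
  the product space over the index set \<open>{1..p}\<close>, and matrices are functions of two indices of
  which only the entries with both indices in the index set matter.
\<close>

abbreviation euclid :: "nat set \<Rightarrow> (nat \<Rightarrow> real) measure" where
  "euclid I \<equiv> Pi\<^sub>M I (\<lambda>_. borel)"

definition is_psd_sqrt :: "nat set \<Rightarrow> (nat \<Rightarrow> nat \<Rightarrow> real) \<Rightarrow> (nat \<Rightarrow> nat \<Rightarrow> real) \<Rightarrow> bool" where
  "is_psd_sqrt I S A \<longleftrightarrow>
     (\<forall>i\<in>I. \<forall>j\<in>I. A i j = A j i) \<and>
     (\<forall>x. 0 \<le> (\<Sum>i\<in>I. \<Sum>j\<in>I. x i * A i j * x j)) \<and>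
     (\<forall>i\<in>I. \<forall>j\<in>I. (\<Sum>k\<in>I. A i k * A k j) = S i j)"

definition psd_sqrt :: "nat set \<Rightarrow> (nat \<Rightarrow> nat \<Rightarrow> real) \<Rightarrow> nat \<Rightarrow> nat \<Rightarrow> real" where
  "psd_sqrt I S = (SOME A. is_psd_sqrt I S A)"

text \<open>
  The possibly degenerate normal distribution \<open>N(m, S)\<close>, as the law of \<open>m + S\<^sup>1\<^sup>/\<^sup>2 Z\<close> for a
  vector \<open>Z\<close> of independent standard normal variables. It is meaningful only if \<open>S\<close> is positive
  semidefinite.
\<close>
definition multi_normal ::
    "nat set \<Rightarrow> (nat \<Rightarrow> real) \<Rightarrow> (nat \<Rightarrow> nat \<Rightarrow> real) \<Rightarrow> (nat \<Rightarrow> real) measure" where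
  "multi_normal I m S =
     distr (Pi\<^sub>M I (\<lambda>_. density lborel std_normal_density)) (euclid I)
       (\<lambda>z. \<lambda>i\<in>I. m i + (\<Sum>j\<in>I. psd_sqrt I S i j * z j))"

definition equal_groups :: "nat \<Rightarrow> nat \<Rightarrow> (nat \<Rightarrow> nat set) \<Rightarrow> bool" where
  "equal_groups p R B \<longleftrightarrow>
     (\<Union>k\<in>{1..R}. B k) = {1..p} \<and> disjoint_family_on B {1..R} \<and>
     (\<forall>k\<in>{1..R}. card (B k) = p div R)"

definition group_cov :: "real \<Rightarrow> nat \<Rightarrow> (nat \<Rightarrow> nat set) \<Rightarrow> nat \<Rightarrow> nat \<Rightarrow> real" where
  "group_cov \<gamma> R B i j =
     (1 - \<gamma>) * of_bool (i = j) + \<gamma> * (\<Sum>k=1..R. indicator (B k) i * indicator (B k) j)"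

definition obs_law ::
    "nat \<Rightarrow> real \<Rightarrow> nat \<Rightarrow> (nat \<Rightarrow> nat set) \<Rightarrow> (nat \<Rightarrow> real) \<Rightarrow> (nat \<Rightarrow> real) measure" where
  "obs_law p \<gamma> R B \<theta> = multi_normal {1..p} \<theta> (group_cov \<gamma> R B)"

definition sparse_alternatives :: "nat \<Rightarrow> nat \<Rightarrow> real \<Rightarrow> (nat \<Rightarrow> real) set" where
  "sparse_alternatives p s \<epsilon> =
     {\<theta> \<in> space (euclid {1..p}). L2_set \<theta> {1..p} \<ge> \<epsilon> \<and> card {i\<in>{1..p}. \<theta> i \<noteq> 0} \<le> s}"

text \<open>
  For \<open>1 \<le> s \<le> p\<close> the set of alternatives is nonempty, so the real supremum and infimum below
  are those of nonempty bounded sets.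
\<close>
definition minimax_risk ::
    "nat \<Rightarrow> nat \<Rightarrow> real \<Rightarrow> nat \<Rightarrow> (nat \<Rightarrow> nat set) \<Rightarrow> real \<Rightarrow> real" where
  "minimax_risk p s \<gamma> R B \<epsilon> =
     (INF \<phi> \<in> euclid {1..p} \<rightarrow>\<^sub>M count_space {0, 1 :: nat}.
        measure (obs_law p \<gamma> R B (\<lambda>i\<in>{1..p}. 0)) {x \<in> space (euclid {1..p}). \<phi> x = 1} +
        (SUP \<theta> \<in> sparse_alternatives p s \<epsilon>.
           measure (obs_law p \<gamma> R B \<theta>) {x \<in> space (euclid {1..p}). \<phi> x = 0}))"

text \<open>
  \<open>r\<close> is a minimax separation rate on the set \<open>A\<close> of parameters \<open>(p, s, \<gamma>, R)\<close>. The constants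
  depend on \<open>\<eta>\<close> only. Where the rate is degenerate (equal to zero), the two conditions with
  constants are replaced by the requirement that the risk vanishes at every positive radius.
\<close>
definition minimax_separation_rate ::
    "(nat \<times> nat \<times> real \<times> nat) set \<Rightarrow> (nat \<Rightarrow> nat \<Rightarrow> real \<Rightarrow> nat \<Rightarrow> real) \<Rightarrow> bool" where
  "minimax_separation_rate A r \<longleftrightarrow>
     (\<forall>(p, s, \<gamma>, R) \<in> A. 0 \<le> r p s \<gamma> R) \<and>
     (\<forall>(p, s, \<gamma>, R) \<in> A. \<forall>B. equal_groups p R B \<longrightarrow> r p s \<gamma> R = 0 \<longrightarrow>
        (\<forall>\<epsilon>>0. minimax_risk p s \<gamma> R B \<epsilon> = 0)) \<and>
     (\<forall>\<eta>\<in>{0<..<1}. \<exists>C\<^sub>\<eta>>0. \<forall>C>C\<^sub>\<eta>.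
        \<forall>(p, s, \<gamma>, R) \<in> A. \<forall>B. equal_groups p R B \<longrightarrow> 0 < r p s \<gamma> R \<longrightarrow>
          minimax_risk p s \<gamma> R B (C * r p s \<gamma> R) \<le> \<eta>) \<and>
     (\<forall>\<eta>\<in>{0<..<1}. \<exists>c\<^sub>\<eta>>0. \<forall>c. 0 < c \<and> c < c\<^sub>\<eta> \<longrightarrow>
        (\<forall>(p, s, \<gamma>, R) \<in> A. \<forall>B. equal_groups p R B \<longrightarrow> 0 < r p s \<gamma> R \<longrightarrow>
          1 - \<eta> \<le> minimax_risk p s \<gamma> R B (c * r p s \<gamma> R)))"

text \<open>For the covariance matrices above, the square root that \<open>psd_sqrt\<close> chooses does exist.\<close>

lemma is_psd_sqrt_group_cov:
  assumes B: "equal_groups p R B" and p: "p \<ge> 1" and dvd: "R dvd p"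
    and \<gamma>: "0 \<le> \<gamma>" "\<gamma> \<le> 1"
  shows "is_psd_sqrt {1..p} (group_cov \<gamma> R B) (psd_sqrt {1..p} (group_cov \<gamma> R B))"
proof -
  define n where "n = real (p div R)"
  define a where "a = sqrt (1 - \<gamma>)"
  define b where "b = (sqrt (1 - \<gamma> + \<gamma> * n) - a) / n"
  define J where "J i j = (\<Sum>k=1..R. indicator (B k) i * indicator (B k) j :: real)" for i j
  define A where "A i j = a * of_bool (i = j) + b * J i j" for i j
  have "p div R > 0"
    using p dvd by (auto elim!: dvdE)
  hence n: "n > 0" by (simp add: n_def)
  have b0: "b \<ge> 0"
    using n \<gamma> by (simp add: b_def a_def)
  have a0: "a \<ge> 0" using \<gamma> by (simp add: a_def)
  have sub: "B k \<subseteq> {1..p}" if "k \<in> {1..R}" for k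
    using B that unfolding equal_groups_def by blast
  have ind: "(\<Sum>l=1..p. indicator (B k) l * indicator (B k') l) = (if k = k' then n else 0 :: real)"
    if k: "k \<in> {1..R}" "k' \<in> {1..R}" for k k'
  proof -
    have "(\<Sum>l=1..p. indicator (B k) l * indicator (B k') l)
        = (\<Sum>l=1..p. indicator (B k \<inter> B k') l :: real)"
      by (intro sum.cong) (auto simp: indicator_def)
    also have "\<dots> = real (card ({1..p} \<inter> (B k \<inter> B k')))"
      using sum_indicator_eq_card[of "{1..p}" "B k \<inter> B k'"]
      by (simp add: indicator_def of_bool_def sum.If_cases)
    also have "{1..p} \<inter> (B k \<inter> B k') = (if k = k' then B k else {})"
      using k sub[of k] B unfolding equal_groups_def disjoint_family_on_def by auto
    finally show ?thesis
      using k B by (auto simp: equal_groups_def n_def)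
  qed
  have JJ: "(\<Sum>l=1..p. J i l * J l j) = n * J i j" for i j
  proof -
    have "(\<Sum>l=1..p. J i l * J l j) = (\<Sum>l=1..p. \<Sum>k=1..R. \<Sum>k'=1..R.
        indicator (B k) i * indicator (B k') j * (indicator (B k) l * indicator (B k') l))"
      unfolding J_def sum_product by (intro sum.cong refl) (simp only: mult_ac)
    also have "\<dots> = (\<Sum>k=1..R. \<Sum>l=1..p. \<Sum>k'=1..R.
        indicator (B k) i * indicator (B k') j * (indicator (B k) l * indicator (B k') l))"
      by (rule sum.swap)
    also have "\<dots> = (\<Sum>k=1..R. \<Sum>k'=1..R. \<Sum>l=1..p.
        indicator (B k) i * indicator (B k') j * (indicator (B k) l * indicator (B k') l))"
      by (intro sum.cong refl sum.swap)
    also have "\<dots> = (\<Sum>k=1..R. \<Sum>k'=1..R.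
        indicator (B k) i * indicator (B k') j * (if k = k' then n else 0))"
      by (intro sum.cong refl) (simp only: sum_distrib_left[symmetric] ind)
    also have "\<dots> = (\<Sum>k=1..R. indicator (B k) i * indicator (B k) j * n)"
      by (intro sum.cong refl) (simp add: if_distrib[of "\<lambda>x. _ * x"] cong: if_cong)
    finally show ?thesis
      by (simp only: J_def sum_distrib_left mult_ac)
  qed
  have ab: "2 * a * b + b * b * n = \<gamma>"
  proof -
    have "a + b * n = sqrt (1 - \<gamma> + \<gamma> * n)" using n by (simp add: b_def)
    hence "(a + b * n)\<^sup>2 = 1 - \<gamma> + \<gamma> * n" using \<gamma> n by simp
    moreover have "a\<^sup>2 = 1 - \<gamma>" using \<gamma> by (simp add: a_def)
    ultimately have "(2 * a * b + b * b * n) * n = \<gamma> * n"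
      by (simp add: power2_eq_square algebra_simps)
    with n show ?thesis by simp
  qed
  have "is_psd_sqrt {1..p} (group_cov \<gamma> R B) A"
    unfolding is_psd_sqrt_def
  proof (intro conjI ballI allI)
    fix i j assume ij: "i \<in> {1..p}" "j \<in> {1..p}"
    show "A i j = A j i" by (auto simp: A_def J_def mult_ac)
    have "(\<Sum>l=1..p. A i l * A l j)
        = (\<Sum>l=1..p. a * a * (of_bool (i = l) * of_bool (l = j)) + a * b * (of_bool (i = l) * J l j)
             + a * b * (J i l * of_bool (l = j)) + b * b * (J i l * J l j))"
      by (intro sum.cong refl) (simp add: A_def algebra_simps)
    also have "\<dots> = a * a * (\<Sum>l=1..p. of_bool (i = l) * of_bool (l = j))
        + a * b * (\<Sum>l=1..p. of_bool (i = l) * J l j)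
        + a * b * (\<Sum>l=1..p. J i l * of_bool (l = j)) + b * b * (n * J i j)"
      by (simp only: sum.distrib sum_distrib_left[symmetric] JJ)
    also have "(\<Sum>l=1..p. of_bool (i = l) * of_bool (l = j)) = (of_bool (i = j) :: real)"
      using ij by (simp add: of_bool_def if_distrib[of "\<lambda>x. x * _"] cong: if_cong)
    also have "(\<Sum>l=1..p. of_bool (i = l) * J l j) = J i j"
      using ij by (simp add: of_bool_def if_distrib[of "\<lambda>x. x * _"] cong: if_cong)
    also have "(\<Sum>l=1..p. J i l * of_bool (l = j)) = J i j"
      using ij by (simp add: of_bool_def if_distrib[of "\<lambda>x. _ * x"] cong: if_cong)
    also have "a * a * of_bool (i = j) + a * b * J i j + a * b * J i j + b * b * (n * J i j)
        = a * a * of_bool (i = j) + (2 * a * b + b * b * n) * J i j"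
      by (simp add: algebra_simps)
    also have "a * a = 1 - \<gamma>" using \<gamma> by (simp add: a_def)
    finally show "(\<Sum>l=1..p. A i l * A l j) = group_cov \<gamma> R B i j"
      by (simp add: ab group_cov_def J_def)
  next
    fix x :: "nat \<Rightarrow> real"
    have "(\<Sum>i=1..p. \<Sum>j=1..p. x i * A i j * x j)
        = (\<Sum>i=1..p. \<Sum>j=1..p. a * (x i * x j * of_bool (i = j)) + b * (x i * J i j * x j))"
      by (intro sum.cong refl) (simp add: A_def algebra_simps)
    also have "\<dots> = a * (\<Sum>i=1..p. \<Sum>j=1..p. x i * x j * of_bool (i = j))
        + b * (\<Sum>i=1..p. \<Sum>j=1..p. x i * J i j * x j)"
      by (simp only: sum.distrib sum_distrib_left[symmetric])
    also have "(\<Sum>i=1..p. \<Sum>j=1..p. x i * x j * of_bool (i = j)) = (\<Sum>i=1..p. x i * x i)"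
      by (intro sum.cong refl) (simp add: of_bool_def if_distrib[of "\<lambda>x. _ * x"] cong: if_cong)
    also have "(\<Sum>i=1..p. \<Sum>j=1..p. x i * J i j * x j)
        = (\<Sum>i=1..p. \<Sum>j=1..p. \<Sum>k=1..R. (indicator (B k) i * x i) * (indicator (B k) j * x j))"
      unfolding J_def sum_distrib_left sum_distrib_right
      by (intro sum.cong refl) (simp only: mult_ac)
    also have "\<dots> = (\<Sum>i=1..p. \<Sum>k=1..R. \<Sum>j=1..p. (indicator (B k) i * x i) * (indicator (B k) j * x j))"
      by (intro sum.cong refl sum.swap)
    also have "\<dots> = (\<Sum>k=1..R. \<Sum>i=1..p. \<Sum>j=1..p. (indicator (B k) i * x i) * (indicator (B k) j * x j))"
      by (rule sum.swap)
    also have "\<dots> = (\<Sum>k=1..R. (\<Sum>i=1..p. indicator (B k) i * x i)\<^sup>2)"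
      by (simp only: power2_eq_square sum_product)
    finally show "0 \<le> (\<Sum>i=1..p. \<Sum>j=1..p. x i * A i j * x j)"
      using a0 b0 by (simp add: sum_nonneg)
  qed
  thus ?thesis unfolding psd_sqrt_def by (rule someI[where P = "is_psd_sqrt {1..p} (group_cov \<gamma> R B)"])
qed

end

theory Submission
  imports Defs
begin

text \<open>
  At \<open>\<gamma> = 1\<close> every group shares one standard normal noise variable: \<open>X i = \<theta> i + w k\<close> for \<open>i\<close> in the
  group \<open>k\<close>, with independent \<open>w 1, \<dots>, w R\<close> (\<open>obs_law_degenerate\<close>). Differences within a group are
  free of noise, so a mean vector that is not constant on the groups is detected without error. Write
  \<open>n = p / R\<close>. A nonzero group-constant mean has at least \<open>n\<close> nonzero coordinates, hence the rate is zero
  for \<open>s < n\<close>. Otherwise it remains to test whether a vector \<open>\<mu>\<close> of \<open>R\<close> group means with at most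
  \<open>\<sigma> = s / n\<close> nonzero entries vanishes, given \<open>\<mu> + w\<close>, and \<open>\<parallel>\<theta>\<parallel>\<^sup>2 = n \<parallel>\<mu>\<parallel>\<^sup>2\<close>
  (\<open>minimax_risk_le_of_group_test\<close>, \<open>minimax_risk_ge_of_group_prior\<close>). In this sparse normal means
  problem the squared rate is \<open>\<sigma> ln (1 + R / \<sigma>\<^sup>2)\<close> for \<open>\<sigma> < \<surd>R\<close> and \<open>\<surd>R\<close> for \<open>\<sigma> \<ge> \<surd>R\<close>.

  Upper bounds. For \<open>\<sigma> \<ge> \<surd>R\<close> the chi-square test and Chebyshev's inequality suffice. For \<open>\<sigma> < \<surd>R\<close> the
  statistic is the centred sum of the squared excesses \<open>(\<bar>x\<bar> - t)\<^sub>+\<^sup>2\<close> with \<open>t\<^sup>2 = 4 ln (1 + R / \<sigma>\<^sup>2)\<close>. Its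
  standard deviation under the null hypothesis is at most of the order of \<open>\<sigma>\<close>; under the
  alternative, the triangle inequality on the support of \<open>\<mu>\<close> bounds the statistic from below
  (\<open>excess_statistic_type_II\<close>).

  Lower bound. The prior puts a common value \<open>a\<close> on one random index in each of \<open>r\<close> disjoint blocks of
  group indices, where \<open>r\<close> is the integer part of the minimum of \<open>\<sigma>\<close> and \<open>\<surd>R\<close>. The second moment of its likelihood
  ratio factorizes over the blocks and is close to \<open>1\<close> if \<open>exp (a\<^sup>2) - 1\<close> is a small multiple of
  \<open>R / r\<^sup>2\<close>; then no test separates the prior from the null hypothesis (\<open>gauss_shifted_mixture_bound\<close>).
\<close>

section \<open>Independent standard normal coordinates\<close>

text \<open>The law of a family of independent standard normal variables indexed by \<open>I\<close>.\<close>
abbreviation gauss :: "nat set \<Rightarrow> (nat \<Rightarrow> real) measure" where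
  "gauss I \<equiv> Pi\<^sub>M I (\<lambda>_. std_normal_distribution)"

lemma prob_space_std_normal: "prob_space std_normal_distribution"
  using real_dist_normal_dist by (simp add: real_distribution_def)

lemma product_prob_space_std_normal: "product_prob_space (\<lambda>_. std_normal_distribution)"
  by (intro product_prob_spaceI prob_space_std_normal)

lemma prob_space_gauss: "prob_space (gauss I)"
  by (intro prob_space_PiM prob_space_std_normal)

lemma sets_gauss [measurable_cong]: "sets (gauss I) = sets (Pi\<^sub>M I (\<lambda>_. borel))"
  by (intro sets_PiM_cong) auto

lemma std_normal_mgf_nn:
  "(\<integral>\<^sup>+x. ennreal (exp (a * x)) \<partial>std_normal_distribution) = ennreal (exp (a\<^sup>2 / 2))"
proof -
  have eq: "std_normal_density x * exp (a * x) = exp (a\<^sup>2 / 2) * normal_density a 1 x" for x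
    by (simp add: normal_density_def std_normal_density_def exp_add[symmetric] power2_eq_square field_simps)
  have "(\<integral>\<^sup>+x. ennreal (exp (a * x)) \<partial>std_normal_distribution)
      = (\<integral>\<^sup>+x. ennreal (std_normal_density x) * ennreal (exp (a * x)) \<partial>lborel)"
    by (intro nn_integral_density) auto
  also have "\<dots> = (\<integral>\<^sup>+x. ennreal (exp (a\<^sup>2 / 2)) * ennreal (normal_density a 1 x) \<partial>lborel)"
    by (intro nn_integral_cong) (simp only: ennreal_mult[symmetric] normal_density_nonneg exp_ge_zero eq)
  also have "\<dots> = ennreal (exp (a\<^sup>2 / 2)) * (\<integral>\<^sup>+x. ennreal (normal_density a 1 x) \<partial>lborel)"
    by (intro nn_integral_cmult) auto
  also have "(\<integral>\<^sup>+x. ennreal (normal_density a 1 x) \<partial>lborel) = 1"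
    using prob_space.emeasure_space_1[OF prob_space_normal_density[of 1 a]]
    by (simp add: emeasure_density)
  finally show ?thesis by simp
qed

lemma std_normal_mgf:
  shows "integrable std_normal_distribution (\<lambda>x. exp (a * x))"
    and "(\<integral>x. exp (a * x) \<partial>std_normal_distribution) = exp (a\<^sup>2 / 2)"
proof -
  have "has_bochner_integral std_normal_distribution (\<lambda>x. exp (a * x)) (exp (a\<^sup>2 / 2))"
    by (intro has_bochner_integral_nn_integral) (auto simp: std_normal_mgf_nn)
  thus "integrable std_normal_distribution (\<lambda>x. exp (a * x))"
    and "(\<integral>x. exp (a * x) \<partial>std_normal_distribution) = exp (a\<^sup>2 / 2)"
    by (auto simp: has_bochner_integral_iff)
qed

lemma gauss_mgf:
  assumes "finite I"
  shows "integrable (gauss I) (\<lambda>w. exp (\<Sum>k\<in>I. v k * w k))"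
    and "(\<integral>w. exp (\<Sum>k\<in>I. v k * w k) \<partial>gauss I) = exp ((\<Sum>k\<in>I. (v k)\<^sup>2) / 2)"
proof -
  interpret product_prob_space "\<lambda>_. std_normal_distribution"
    by (rule product_prob_space_std_normal)
  show "integrable (gauss I) (\<lambda>w. exp (\<Sum>k\<in>I. v k * w k))"
    using product_integrable_prod[OF assms, of "\<lambda>k x. exp (v k * x)"] std_normal_mgf(1)
    by (simp add: exp_sum assms)
  show "(\<integral>w. exp (\<Sum>k\<in>I. v k * w k) \<partial>gauss I) = exp ((\<Sum>k\<in>I. (v k)\<^sup>2) / 2)"
    using product_integral_prod[OF assms, of "\<lambda>k x. exp (v k * x)"] std_normal_mgf
    by (simp add: exp_sum assms sum_divide_distrib)
qed

lemma PiM_integrable_component: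
  fixes f :: "'b \<Rightarrow> real"
  assumes M: "\<And>i. i \<in> I \<Longrightarrow> prob_space (M i)" and k: "k \<in> I"
    and f: "integrable (M k) f"
  shows "integrable (Pi\<^sub>M I M) (\<lambda>w. f (w k))"
    and "(\<integral>w. f (w k) \<partial>Pi\<^sub>M I M) = integral\<^sup>L (M k) f"
proof -
  have d: "distr (Pi\<^sub>M I M) (M k) (\<lambda>w. w k) = M k"
    using M k by (rule distr_PiM_component)
  have m: "(\<lambda>w. w k) \<in> Pi\<^sub>M I M \<rightarrow>\<^sub>M M k"
    using k by (rule measurable_component_singleton)
  have "integrable (distr (Pi\<^sub>M I M) (M k) (\<lambda>w. w k)) f"
    unfolding d by (rule f)
  thus "integrable (Pi\<^sub>M I M) (\<lambda>w. f (w k))"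
    by (rule integrable_distr[OF m])
  have "(\<integral>w. f (w k) \<partial>Pi\<^sub>M I M) = integral\<^sup>L (distr (Pi\<^sub>M I M) (M k) (\<lambda>w. w k)) f"
    using f by (intro integral_distr[symmetric] m) auto
  thus "(\<integral>w. f (w k) \<partial>Pi\<^sub>M I M) = integral\<^sup>L (M k) f"
    unfolding d .
qed

text \<open>
  Chebyshev's inequality for a sum of independent variables, with the variance of each summand
  bounded by its second moment.
\<close>
lemma PiM_sum_Chebyshev:
  fixes h :: "'i \<Rightarrow> 'b \<Rightarrow> real"
  assumes M: "\<And>i. prob_space (M i)" and I: "finite I"
    and h [measurable]: "\<And>k. h k \<in> borel_measurable (M k)"
    and h2: "\<And>k. k \<in> I \<Longrightarrow> integrable (M k) (\<lambda>x. (h k x)\<^sup>2)"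
    and a: "a > 0"
  shows "measure (Pi\<^sub>M I M)
      {w \<in> space (Pi\<^sub>M I M). a \<le> \<bar>(\<Sum>k\<in>I. h k (w k)) - (\<Sum>k\<in>I. integral\<^sup>L (M k) (h k))\<bar>}
    \<le> (\<Sum>k\<in>I. \<integral>x. (h k x)\<^sup>2 \<partial>M k) / a\<^sup>2"
proof -
  interpret product_prob_space M using M by (intro product_prob_spaceI)
  define c where "c k = integral\<^sup>L (M k) (h k)" for k
  define g where "g k x = h k x - c k" for k x
  have g [measurable]: "g k \<in> borel_measurable (M k)" for k
    unfolding g_def by measurable
  have h1: "integrable (M k) (h k)" if "k \<in> I" for k
  proof -
    show ?thesis using M.square_integrable_imp_integrable[OF h h2[OF that]] .
  qed
  have g1: "integrable (M k) (g k)" and g0: "integral\<^sup>L (M k) (g k) = 0" if "k \<in> I" for k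
  proof -
    show "integrable (M k) (g k)" unfolding g_def using h1[OF that] by simp
    show "integral\<^sup>L (M k) (g k) = 0" unfolding g_def c_def using h1[OF that]
      by (simp add: M.prob_space)
  qed
  have g2: "integrable (M k) (\<lambda>x. (g k x)\<^sup>2)"
    and g2': "(\<integral>x. (g k x)\<^sup>2 \<partial>M k) \<le> (\<integral>x. (h k x)\<^sup>2 \<partial>M k)" if "k \<in> I" for k
  proof -
    have eq: "(g k x)\<^sup>2 = (h k x)\<^sup>2 - 2 * c k * h k x + (c k)\<^sup>2" for x
      by (simp add: g_def power2_eq_square algebra_simps)
    show "integrable (M k) (\<lambda>x. (g k x)\<^sup>2)"
      unfolding eq using h1[OF that] h2[OF that] by simp
    have "(\<integral>x. (g k x)\<^sup>2 \<partial>M k) = (\<integral>x. (h k x)\<^sup>2 \<partial>M k) - 2 * c k * c k + (c k)\<^sup>2"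
      unfolding eq using h1[OF that] h2[OF that] by (simp add: M.prob_space c_def[symmetric])
    thus "(\<integral>x. (g k x)\<^sup>2 \<partial>M k) \<le> (\<integral>x. (h k x)\<^sup>2 \<partial>M k)"
      by (simp add: power2_eq_square) 
  qed
  have cross: "integrable (Pi\<^sub>M I M) (\<lambda>w. g k (w k) * g l (w l)) \<and>
      (\<integral>w. g k (w k) * g l (w l) \<partial>Pi\<^sub>M I M) = (if k = l then \<integral>x. (g k x)\<^sup>2 \<partial>M k else 0)"
    if kl: "k \<in> I" "l \<in> I" for k l
  proof (cases "k = l")
    case True
    thus ?thesis
      using PiM_integrable_component[of I M k "\<lambda>x. (g k x)\<^sup>2", OF M kl(1) g2[OF kl(1)]] by (simp add: power2_eq_square)
  next
    case False
    \<comment> \<open>Padding with constant factors makes the integrand a product over all of \<open>I\<close>.\<close>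
    define f where "f j = (if j = k \<or> j = l then g j else (\<lambda>_. 1))" for j
    have fI: "integrable (M j) (f j)" if "j \<in> I" for j
    proof -
      show ?thesis using g1[OF that] by (simp add: f_def)
    qed
    have prod: "(\<Prod>j\<in>I. f j (w j)) = g k (w k) * g l (w l)" for w
    proof -
      have "(\<Prod>j\<in>I. f j (w j)) = (\<Prod>j\<in>{k, l}. f j (w j))"
        using kl I by (intro prod.mono_neutral_right) (auto simp: f_def)
      thus ?thesis using False by (simp add: f_def)
    qed
    have "(\<Prod>j\<in>I. integral\<^sup>L (M j) (f j)) = 0"
      using kl g0[OF kl(1)] I by (intro prod_zero) (auto simp: f_def intro!: bexI[of _ k])
    thus ?thesis
      using product_integrable_prod[OF I, of f] product_integral_prod[OF I, of f] fI False
      by (simp add: prod)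
  qed
  have sq: "(\<Sum>k\<in>I. g k (w k))\<^sup>2 = (\<Sum>k\<in>I. \<Sum>l\<in>I. g k (w k) * g l (w l))" for w
    by (simp add: power2_eq_square sum_product)
  have int: "integrable (Pi\<^sub>M I M) (\<lambda>w. (\<Sum>k\<in>I. g k (w k))\<^sup>2)"
    unfolding sq by (intro Bochner_Integration.integrable_sum) (auto simp: cross)
  have "(\<integral>w. (\<Sum>k\<in>I. g k (w k))\<^sup>2 \<partial>Pi\<^sub>M I M)
      = (\<Sum>k\<in>I. \<Sum>l\<in>I. \<integral>w. g k (w k) * g l (w l) \<partial>Pi\<^sub>M I M)"
    unfolding sq by (simp add: Bochner_Integration.integral_sum cross)
  also have "\<dots> = (\<Sum>k\<in>I. \<integral>x. (g k x)\<^sup>2 \<partial>M k)"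
    using I by (simp add: cross)
  also have "\<dots> \<le> (\<Sum>k\<in>I. \<integral>x. (h k x)\<^sup>2 \<partial>M k)"
    by (intro sum_mono g2')
  finally have var: "(\<integral>w. (\<Sum>k\<in>I. g k (w k))\<^sup>2 \<partial>Pi\<^sub>M I M) \<le> (\<Sum>k\<in>I. \<integral>x. (h k x)\<^sup>2 \<partial>M k)" .
  have "measure (Pi\<^sub>M I M) {w \<in> space (Pi\<^sub>M I M). a \<le> \<bar>\<Sum>k\<in>I. g k (w k)\<bar>}
      = measure (Pi\<^sub>M I M) {w \<in> space (Pi\<^sub>M I M). a\<^sup>2 \<le> (\<Sum>k\<in>I. g k (w k))\<^sup>2}"
    using a by (intro arg_cong[where f = "measure _"] Collect_cong conj_cong refl)
      (metis abs_le_square_iff abs_of_pos)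
  also have "\<dots> \<le> (\<integral>w. (\<Sum>k\<in>I. g k (w k))\<^sup>2 \<partial>Pi\<^sub>M I M) / a\<^sup>2"
    using int a by (intro integral_Markov_inequality_measure[where A = "{}"]) auto
  also have "\<dots> \<le> (\<Sum>k\<in>I. \<integral>x. (h k x)\<^sup>2 \<partial>M k) / a\<^sup>2"
    using var by (intro divide_right_mono) auto
  finally show ?thesis
    by (simp add: g_def c_def sum_subtractf)
qed

lemma gauss_sum_Chebyshev:
  fixes h :: "nat \<Rightarrow> real \<Rightarrow> real"
  assumes "finite I" and "\<And>k. h k \<in> borel_measurable borel"
    and "\<And>k. k \<in> I \<Longrightarrow> integrable std_normal_distribution (\<lambda>x. (h k x)\<^sup>2)" and "a > 0"
  shows "measure (gauss I) {w \<in> space (gauss I).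
      a \<le> \<bar>(\<Sum>k\<in>I. h k (w k)) - (\<Sum>k\<in>I. integral\<^sup>L std_normal_distribution (h k))\<bar>}
    \<le> (\<Sum>k\<in>I. \<integral>x. (h k x)\<^sup>2 \<partial>std_normal_distribution) / a\<^sup>2"
  using assms by (intro PiM_sum_Chebyshev prob_space_std_normal) auto

lemma std_normal_moments:
  "(\<integral>x. x \<partial>std_normal_distribution) = 0"
  "(\<integral>x. x\<^sup>2 \<partial>std_normal_distribution) = 1"
  "(\<integral>x. (x\<^sup>2)\<^sup>2 \<partial>std_normal_distribution) = 3"
  using integral_std_normal_distribution_moment_odd[of 1] std_normal_distribution_even_moments(1)[of 1]
    std_normal_distribution_even_moments(1)[of 2]
  by (simp_all add: fact_numeral power_mult[symmetric])

section \<open>Shifts of the standard normal law\<close>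

lemma distr_std_normal_shift:
  "distr std_normal_distribution borel (\<lambda>x. x + v)
     = density std_normal_distribution (\<lambda>x. ennreal (exp (v * x - v\<^sup>2 / 2)))"
proof -
  interpret prob_space std_normal_distribution by (rule prob_space_std_normal)
  have "distributed std_normal_distribution lborel (\<lambda>x. x) std_normal_density"
    by (auto simp: distributed_def distr_id2)
  from normal_density_affine[OF this, of 1 v]
  have "distributed std_normal_distribution lborel (\<lambda>x. x + v) (normal_density v 1)"
    by (simp add: add.commute)
  hence "distr std_normal_distribution lborel (\<lambda>x. x + v) = density lborel (normal_density v 1)"
    by (simp add: distributed_def)
  moreover have "distr std_normal_distribution lborel (\<lambda>x. x + v) = distr std_normal_distribution borel (\<lambda>x. x + v)"
    by (intro distr_cong) auto
  moreover have "density std_normal_distribution (\<lambda>x. ennreal (exp (v * x - v\<^sup>2 / 2)))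
      = density lborel (normal_density v 1)"
  proof -
    have eq: "std_normal_density x * exp (v * x - v\<^sup>2 / 2) = normal_density v 1 x" for x
      by (simp add: normal_density_def std_normal_density_def exp_add[symmetric] power2_eq_square field_simps)
    show ?thesis
      by (subst density_density_eq) (auto simp: ennreal_mult[symmetric] eq)
  qed
  ultimately show ?thesis by simp
qed

text \<open>The likelihood ratio of a shift (the Cameron--Martin formula in finite dimension).\<close>
lemma distr_gauss_shift:
  assumes I: "finite I"
  shows "distr (gauss I) (gauss I) (\<lambda>w. \<lambda>k\<in>I. w k + v k)
    = density (gauss I) (\<lambda>w. ennreal (exp ((\<Sum>k\<in>I. v k * w k) - (\<Sum>k\<in>I. (v k)\<^sup>2) / 2)))"
proof -
  define Q where "Q k = density std_normal_distribution (\<lambda>x. ennreal (exp (v k * x - (v k)\<^sup>2 / 2)))" for k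
  have Q: "Q k = distr std_normal_distribution borel (\<lambda>x. x + v k)" for k
    unfolding Q_def by (rule distr_std_normal_shift[symmetric])
  interpret N: product_prob_space "\<lambda>_. std_normal_distribution"
    by (rule product_prob_space_std_normal)
  have "prob_space (Q k)" for k
    unfolding Q by (intro prob_space.prob_space_distr prob_space_std_normal) auto
  then interpret Q: product_prob_space Q
    by (intro product_prob_spaceI)
  have setsQ: "sets (Pi\<^sub>M I Q) = sets (gauss I)"
    by (intro sets_PiM_cong) (auto simp: Q)
  have m: "(\<lambda>w. \<lambda>k\<in>I. w k + v k) \<in> gauss I \<rightarrow>\<^sub>M gauss I"
    by measurable
  have "distr (gauss I) (gauss I) (\<lambda>w. \<lambda>k\<in>I. w k + v k) = Pi\<^sub>M I Q"
  proof (rule Q.PiM_eqI[OF I])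
    show "sets (distr (gauss I) (gauss I) (\<lambda>w. \<lambda>k\<in>I. w k + v k)) = sets (Pi\<^sub>M I Q)"
      by (simp add: setsQ)
  next
    fix A assume "\<And>i. i \<in> I \<Longrightarrow> A i \<in> sets (Q i)"
    hence A: "A i \<in> sets borel" if "i \<in> I" for i
      using that by (auto simp: Q)
    have "emeasure (distr (gauss I) (gauss I) (\<lambda>w. \<lambda>k\<in>I. w k + v k)) (Pi\<^sub>E I A)
        = emeasure (gauss I) ((\<lambda>w. \<lambda>k\<in>I. w k + v k) -` Pi\<^sub>E I A \<inter> space (gauss I))"
      using A I by (intro emeasure_distr m sets_PiM_I_finite) auto
    also have "(\<lambda>w. \<lambda>k\<in>I. w k + v k) -` Pi\<^sub>E I A \<inter> space (gauss I)
        = Pi\<^sub>E I (\<lambda>k. (\<lambda>x. x + v k) -` A k)"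
      by (auto simp: space_PiM PiE_def Pi_def extensional_def)
    also have "emeasure (gauss I) (Pi\<^sub>E I (\<lambda>k. (\<lambda>x. x + v k) -` A k))
        = (\<Prod>k\<in>I. emeasure std_normal_distribution ((\<lambda>x. x + v k) -` A k))"
    proof (intro N.emeasure_PiM I)
      fix k assume "k \<in> I"
      show "(\<lambda>x. x + v k) -` A k \<in> sets std_normal_distribution"
        using measurable_sets[OF _ A[OF \<open>k \<in> I\<close>], of "\<lambda>x. x + v k" borel] by simp
    qed
    also have "\<dots> = (\<Prod>k\<in>I. emeasure (Q k) (A k))"
      using A by (intro prod.cong refl) (simp add: Q emeasure_distr)
    finally show "emeasure (distr (gauss I) (gauss I) (\<lambda>w. \<lambda>k\<in>I. w k + v k)) (Pi\<^sub>E I A)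
        = (\<Prod>k\<in>I. emeasure (Q k) (A k))" .
  qed
  moreover have "density (gauss I) (\<lambda>w. ennreal (exp ((\<Sum>k\<in>I. v k * w k) - (\<Sum>k\<in>I. (v k)\<^sup>2) / 2))) = Pi\<^sub>M I Q"
    (is "density _ ?f = _")
  proof (rule Q.PiM_eqI[OF I])
    show "sets (density (gauss I) ?f) = sets (Pi\<^sub>M I Q)"
      by (simp add: setsQ)
  next
    fix A assume "\<And>i. i \<in> I \<Longrightarrow> A i \<in> sets (Q i)"
    hence A: "A i \<in> sets borel" if "i \<in> I" for i
      using that by (auto simp: Q)
    have "emeasure (density (gauss I) ?f) (Pi\<^sub>E I A) = (\<integral>\<^sup>+w. ?f w * indicator (Pi\<^sub>E I A) w \<partial>gauss I)"
      using A I by (intro emeasure_density sets_PiM_I_finite) auto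
    also have "\<dots> = (\<integral>\<^sup>+w. (\<Prod>k\<in>I. ennreal (exp (v k * w k - (v k)\<^sup>2 / 2)) * indicator (A k) (w k)) \<partial>gauss I)"
    proof (rule nn_integral_cong)
      fix w assume "w \<in> space (gauss I)"
      hence "indicator (Pi\<^sub>E I A) w = (\<Prod>k\<in>I. indicator (A k) (w k) :: ennreal)"
        using I by (auto simp: indicator_def PiE_def space_PiM Pi_def prod_eq_1_iff intro!: prod_zero[symmetric])
      moreover have "?f w = (\<Prod>k\<in>I. ennreal (exp (v k * w k - (v k)\<^sup>2 / 2)))"
        using I by (simp add: prod_ennreal exp_sum[symmetric] sum_subtractf sum_divide_distrib)
      ultimately show "?f w * indicator (Pi\<^sub>E I A) w
          = (\<Prod>k\<in>I. ennreal (exp (v k * w k - (v k)\<^sup>2 / 2)) * indicator (A k) (w k))"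
        by (simp add: prod.distrib)
    qed
    also have "\<dots> = (\<Prod>k\<in>I. \<integral>\<^sup>+x. ennreal (exp (v k * x - (v k)\<^sup>2 / 2)) * indicator (A k) x \<partial>std_normal_distribution)"
    proof (rule N.product_nn_integral_prod[OF I])
      fix k assume k: "k \<in> I"
      note [measurable] = A[OF k]
      show "(\<lambda>x. ennreal (exp (v k * x - (v k)\<^sup>2 / 2)) * indicator (A k) x)
          \<in> borel_measurable std_normal_distribution"
        by measurable
    qed
    also have "\<dots> = (\<Prod>k\<in>I. emeasure (Q k) (A k))"
      using A by (intro prod.cong refl) (simp add: Q_def emeasure_density)
    finally show "emeasure (density (gauss I) ?f) (Pi\<^sub>E I A) = (\<Prod>k\<in>I. emeasure (Q k) (A k))" .
  qed
  ultimately show ?thesis by simp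
qed

text \<open>
  The second moment method. The likelihood ratio \<open>L\<close> of the uniform mixture of the laws shifted
  by \<open>\<mu> f\<close> has mean \<open>1\<close> and second moment equal to the average of \<open>exp \<langle>\<mu> f, \<mu> g\<rangle>\<close>
  over \<open>f\<close> and \<open>g\<close>. If this is at most \<open>1 + \<delta>\<^sup>2\<close>, then \<open>L\<close> is within \<open>\<delta>\<close> of \<open>1\<close> in mean,
  so no event tells the mixture from the unshifted law by more than \<open>\<delta>\<close>.
\<close>
lemma gauss_shifted_mixture_bound:
  fixes \<mu> :: "'f \<Rightarrow> nat \<Rightarrow> real"
  assumes I: "finite I" and F: "finite F" "F \<noteq> {}" and A [measurable]: "A \<in> sets (gauss I)"
    and \<delta>: "\<delta> > 0"
    and bound: "(\<Sum>f\<in>F. \<Sum>g\<in>F. exp (\<Sum>k\<in>I. \<mu> f k * \<mu> g k)) \<le> (1 + \<delta>\<^sup>2) * (real (card F))\<^sup>2"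
  shows "measure (gauss I) A - \<delta>
    \<le> (\<Sum>f\<in>F. measure (gauss I) {w \<in> space (gauss I). (\<lambda>k\<in>I. w k + \<mu> f k) \<in> A}) / real (card F)"
proof -
  interpret prob_space "gauss I" by (rule prob_space_gauss)
  define N where "N = real (card F)"
  have N: "N > 0" using F by (simp add: N_def card_gt_0_iff)
  define E where "E f w = exp ((\<Sum>k\<in>I. \<mu> f k * w k) - (\<Sum>k\<in>I. (\<mu> f k)\<^sup>2) / 2)" for f w
  define L where "L w = (\<Sum>f\<in>F. E f w) / N" for w
  have intE: "integrable (gauss I) (E f)" and expE: "(\<integral>w. E f w \<partial>gauss I) = 1" for f
  proof -
    show "integrable (gauss I) (E f)"
      unfolding E_def exp_diff using gauss_mgf(1)[OF I] by simp
    show "(\<integral>w. E f w \<partial>gauss I) = 1"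
      unfolding E_def exp_diff using gauss_mgf(2)[OF I, of "\<mu> f"] by simp
  qed
  have EE: "integrable (gauss I) (\<lambda>w. E f w * E g w)"
    "(\<integral>w. E f w * E g w \<partial>gauss I) = exp (\<Sum>k\<in>I. \<mu> f k * \<mu> g k)" for f g
  proof -
    define c where "c = (\<Sum>k\<in>I. (\<mu> f k)\<^sup>2) / 2 + (\<Sum>k\<in>I. (\<mu> g k)\<^sup>2) / 2"
    have eq: "E f w * E g w = exp (\<Sum>k\<in>I. (\<mu> f k + \<mu> g k) * w k) / exp c" for w
      by (simp add: E_def c_def exp_add[symmetric] exp_diff[symmetric] sum.distrib algebra_simps)
    show "integrable (gauss I) (\<lambda>w. E f w * E g w)"
      unfolding eq using gauss_mgf(1)[OF I] by simp
    have "(\<integral>w. E f w * E g w \<partial>gauss I) = exp ((\<Sum>k\<in>I. (\<mu> f k + \<mu> g k)\<^sup>2) / 2) / exp c"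
      unfolding eq using gauss_mgf(2)[OF I, of "\<lambda>k. \<mu> f k + \<mu> g k"] by simp
    also have "\<dots> = exp (\<Sum>k\<in>I. \<mu> f k * \<mu> g k)"
      by (simp add: c_def exp_diff[symmetric] power2_sum sum.distrib add_divide_distrib
          sum_distrib_left[symmetric] mult.assoc)
    finally show "(\<integral>w. E f w * E g w \<partial>gauss I) = exp (\<Sum>k\<in>I. \<mu> f k * \<mu> g k)" .
  qed
  have intL: "integrable (gauss I) L" and expL: "(\<integral>w. L w \<partial>gauss I) = 1"
    unfolding L_def using intE expE N by (simp_all add: N_def)
  have L2: "(L w)\<^sup>2 = (\<Sum>f\<in>F. \<Sum>g\<in>F. E f w * E g w) / N\<^sup>2" for w
    by (simp add: L_def power_divide power2_eq_square sum_product)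
  have intL2: "integrable (gauss I) (\<lambda>w. (L w)\<^sup>2)"
    unfolding L2 using EE(1) by simp
  have "(\<integral>w. (L w)\<^sup>2 \<partial>gauss I) = (\<Sum>f\<in>F. \<Sum>g\<in>F. exp (\<Sum>k\<in>I. \<mu> f k * \<mu> g k)) / N\<^sup>2"
    unfolding L2 using EE by simp
  also have "\<dots> \<le> 1 + \<delta>\<^sup>2"
    using bound N by (simp add: N_def[symmetric] field_simps)
  finally have expL2: "(\<integral>w. (L w)\<^sup>2 \<partial>gauss I) \<le> 1 + \<delta>\<^sup>2" .
  have shift: "measure (gauss I) {w \<in> space (gauss I). (\<lambda>k\<in>I. w k + \<mu> f k) \<in> A}
      = (\<integral>w. E f w * indicator A w \<partial>gauss I)" for f
  proof -
    have "measure (gauss I) {w \<in> space (gauss I). (\<lambda>k\<in>I. w k + \<mu> f k) \<in> A}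
        = measure (distr (gauss I) (gauss I) (\<lambda>w. \<lambda>k\<in>I. w k + \<mu> f k)) A"
      by (subst measure_distr) (auto intro!: arg_cong[where f = "measure _"])
    also have "\<dots> = measure (density (gauss I) (\<lambda>w. ennreal (E f w))) A"
      unfolding distr_gauss_shift[OF I] E_def ..
    also have "\<dots> = (\<integral>w. E f w * indicator A w \<partial>gauss I)"
    proof -
      have "measure (density (gauss I) (\<lambda>w. ennreal (E f w))) A
          = (\<integral>w. indicator A w \<partial>density (gauss I) (\<lambda>w. ennreal (E f w)))"
        by simp
      also have "\<dots> = (\<integral>w. E f w *\<^sub>R indicator A w \<partial>gauss I)"
        by (intro integral_density) (use intE in \<open>auto simp: E_def\<close>)
      finally show ?thesis by simp
    qed
    finally show ?thesis .
  qed
  have "(\<Sum>f\<in>F. measure (gauss I) {w \<in> space (gauss I). (\<lambda>k\<in>I. w k + \<mu> f k) \<in> A}) / N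
      = (\<integral>w. L w * indicator A w \<partial>gauss I)"
  proof -
    have "L w * indicator A w = (\<Sum>f\<in>F. E f w * indicator A w) / N" for w
      by (simp add: L_def sum_distrib_right)
    moreover have "integrable (gauss I) (\<lambda>w. E f w * indicator A w)" for f
      by (intro integrable_real_mult_indicator intE) auto
    ultimately show ?thesis unfolding shift by simp
  qed
  moreover have "measure (gauss I) A - \<delta> \<le> (\<integral>w. L w * indicator A w \<partial>gauss I)"
  proof -
    have int1: "integrable (gauss I) (\<lambda>w. L w * indicator A w)"
      by (intro integrable_real_mult_indicator intL) auto
    have int0: "integrable (gauss I) (indicator A :: _ \<Rightarrow> real)"
      by (intro integrable_real_indicator) (auto simp: less_top[symmetric])
    have "measure (gauss I) A - (\<integral>w. L w * indicator A w \<partial>gauss I)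
        = (\<integral>w. indicator A w - L w * indicator A w \<partial>gauss I)"
      using int0 int1 by (subst Bochner_Integration.integral_diff) auto
    also have "\<dots> \<le> (\<integral>w. ((L w)\<^sup>2 - 2 * L w + 1) / (2 * \<delta>) + \<delta> / 2 \<partial>gauss I)"
    proof (rule integral_mono)
      fix w assume "w \<in> space (gauss I)"
      \<comment> \<open>Replaces the Cauchy--Schwarz inequality: the mean of \<open>\<bar>L - 1\<bar>\<close> is bounded via that of its square.\<close>
      have "0 \<le> (\<bar>L w - 1\<bar> - \<delta>)\<^sup>2" by simp
      hence "\<bar>L w - 1\<bar> * (2 * \<delta>) \<le> (L w - 1)\<^sup>2 + \<delta>\<^sup>2"
        by (simp add: power2_diff)
      hence "\<bar>L w - 1\<bar> \<le> ((L w - 1)\<^sup>2 + \<delta>\<^sup>2) / (2 * \<delta>)"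
        using \<delta> by (simp add: pos_le_divide_eq)
      also have "\<dots> = ((L w)\<^sup>2 - 2 * L w + 1) / (2 * \<delta>) + \<delta> / 2"
        using \<delta> by (simp add: power2_diff power2_eq_square field_simps)
      finally show "indicator A w - L w * indicator A w \<le> ((L w)\<^sup>2 - 2 * L w + 1) / (2 * \<delta>) + \<delta> / 2"
        by (cases "w \<in> A") (auto split: if_splits)
    qed (use int0 int1 intL intL2 in auto)
    also have "\<dots> = ((\<integral>w. (L w)\<^sup>2 \<partial>gauss I) - 2 * 1 + 1) / (2 * \<delta>) + \<delta> / 2"
      using intL intL2 expL by (simp add: prob_space)
    also have "\<dots> \<le> \<delta>\<^sup>2 / (2 * \<delta>) + \<delta> / 2"
      using expL2 \<delta> by (intro add_mono divide_right_mono) auto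
    also have "\<dots> = \<delta>"
      using \<delta> by (simp add: power2_eq_square)
    finally show ?thesis by simp
  qed
  ultimately show ?thesis by (simp add: N_def)
qed

section \<open>The law of the observation at full correlation\<close>

text \<open>
  Uniqueness of the positive semidefinite square root, for a symmetric \<open>S\<close> with \<open>S\<^sup>2 = c S\<close>.
  With \<open>D = S / \<surd>c\<close> and \<open>M = A - D\<close> one has \<open>(A + D) M = 0\<close> because \<open>A\<close> and \<open>D\<close> commute and have
  the same square. For a column \<open>u\<close> of \<open>M\<close> this makes the sum of the two nonnegative forms
  \<open>\<langle>u, A u\<rangle>\<close> and \<open>\<langle>u, D u\<rangle>\<close> vanish. The second is a multiple of \<open>\<parallel>D u\<parallel>\<^sup>2\<close>, so
  \<open>D u = 0\<close>, then \<open>A u = 0\<close>, and hence \<open>M\<^sup>2 = 0\<close>.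
\<close>
lemma psd_sqrt_of_scaled_projection:
  fixes S A :: "nat \<Rightarrow> nat \<Rightarrow> real"
  assumes I: "finite I" and c: "c > 0"
    and sym: "\<And>i j. i \<in> I \<Longrightarrow> j \<in> I \<Longrightarrow> S i j = S j i"
    and SS: "\<And>i j. i \<in> I \<Longrightarrow> j \<in> I \<Longrightarrow> (\<Sum>k\<in>I. S i k * S k j) = c * S i j"
    and A: "is_psd_sqrt I S A"
    and ij: "i \<in> I" "j \<in> I"
  shows "A i j = S i j / sqrt c"
proof -
  define D where "D i j = S i j / sqrt c" for i j
  define M where "M i j = A i j - D i j" for i j
  have Asym: "A i j = A j i" if "i \<in> I" "j \<in> I" for i j
    using A that by (auto simp: is_psd_sqrt_def)
  have Dsym: "D i j = D j i" if "i \<in> I" "j \<in> I" for i j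
    using sym that by (simp add: D_def)
  have AA: "(\<Sum>k\<in>I. A i k * A k j) = S i j" if "i \<in> I" "j \<in> I" for i j
    using A that unfolding is_psd_sqrt_def by blast
  have DD: "(\<Sum>k\<in>I. D i k * D k j) = S i j" if "i \<in> I" "j \<in> I" for i j
  proof -
    have "(\<Sum>k\<in>I. D i k * D k j) = (\<Sum>k\<in>I. S i k * S k j / c)"
      using c by (intro sum.cong refl) (simp add: D_def)
    also have "\<dots> = S i j"
      using SS[OF that] c by (simp add: sum_divide_distrib[symmetric])
    finally show ?thesis .
  qed
  \<comment> \<open>\<open>A\<close> commutes with its square \<open>S\<close>, hence with \<open>D\<close>.\<close>
  have AD: "(\<Sum>k\<in>I. A i k * D k j) = (\<Sum>k\<in>I. D i k * A k j)" if "i \<in> I" "j \<in> I" for i j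
  proof -
    have "(\<Sum>k\<in>I. A i k * S k j) = (\<Sum>k\<in>I. \<Sum>l\<in>I. A i k * (A k l * A l j))"
      using that by (intro sum.cong refl) (simp add: AA[symmetric] sum_distrib_left)
    also have "\<dots> = (\<Sum>l\<in>I. \<Sum>k\<in>I. A i k * (A k l * A l j))"
      by (rule sum.swap)
    also have "\<dots> = (\<Sum>l\<in>I. S i l * A l j)"
      using that by (intro sum.cong refl) (simp add: AA[symmetric] sum_distrib_right mult.assoc)
    finally show ?thesis
      by (simp add: D_def sum_divide_distrib[symmetric])
  qed
  have zero: "(\<Sum>k\<in>I. A i k * M k j) + (\<Sum>k\<in>I. D i k * M k j) = 0" if "i \<in> I" "j \<in> I" for i j
    using AA[OF that] DD[OF that] AD[OF that]
    by (simp add: M_def right_diff_distrib sum_subtractf)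
  have M0: "(\<Sum>k\<in>I. M i k * M k j) = 0" if i: "i \<in> I" and j: "j \<in> I" for i j
  proof -
    define u where "u i = M i j" for i
    have pA: "0 \<le> (\<Sum>i\<in>I. u i * (\<Sum>k\<in>I. A i k * u k))"
      using A by (auto simp: is_psd_sqrt_def sum_distrib_left mult.assoc)
    have "(\<Sum>i\<in>I. (\<Sum>k\<in>I. D i k * u k)\<^sup>2)
        = (\<Sum>i\<in>I. \<Sum>k\<in>I. \<Sum>l\<in>I. u k * (D k i * D i l) * u l)"
      unfolding power2_eq_square sum_product
      by (intro sum.cong refl) (simp add: Dsym mult_ac)
    also have "\<dots> = (\<Sum>k\<in>I. \<Sum>i\<in>I. \<Sum>l\<in>I. u k * (D k i * D i l) * u l)"
      by (rule sum.swap)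
    also have "\<dots> = (\<Sum>k\<in>I. \<Sum>l\<in>I. \<Sum>i\<in>I. u k * (D k i * D i l) * u l)"
      by (intro sum.cong refl sum.swap)
    also have "\<dots> = (\<Sum>k\<in>I. \<Sum>l\<in>I. u k * S k l * u l)"
      by (intro sum.cong refl) (simp add: DD[symmetric] sum_distrib_left sum_distrib_right)
    also have "\<dots> = sqrt c * (\<Sum>i\<in>I. u i * (\<Sum>k\<in>I. D i k * u k))"
      using c by (simp add: D_def sum_distrib_left mult_ac)
    finally have sq: "(\<Sum>i\<in>I. (\<Sum>k\<in>I. D i k * u k)\<^sup>2) = sqrt c * (\<Sum>i\<in>I. u i * (\<Sum>k\<in>I. D i k * u k))" .
    have "(\<Sum>i\<in>I. u i * (\<Sum>k\<in>I. A i k * u k)) + (\<Sum>i\<in>I. u i * (\<Sum>k\<in>I. D i k * u k))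
        = (\<Sum>i\<in>I. u i * ((\<Sum>k\<in>I. A i k * u k) + (\<Sum>k\<in>I. D i k * u k)))"
      by (simp add: sum.distrib distrib_left)
    also have "\<dots> = 0"
      using zero j by (simp add: u_def)
    finally have "sqrt c * (\<Sum>i\<in>I. u i * (\<Sum>k\<in>I. D i k * u k)) \<le> 0"
      using pA c by (simp add: mult_le_0_iff)
    hence "(\<Sum>i\<in>I. (\<Sum>k\<in>I. D i k * u k)\<^sup>2) = 0"
      unfolding sq[symmetric] by (intro antisym sum_nonneg) auto
    hence Du: "(\<Sum>k\<in>I. D i k * u k) = 0"
      using I i by (simp add: sum_nonneg_eq_0_iff)
    hence Au: "(\<Sum>k\<in>I. A i k * u k) = 0"
      using zero[OF i j] by (simp add: u_def)
    show ?thesis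
      using Au Du by (simp add: M_def[of i] u_def left_diff_distrib sum_subtractf)
  qed
  have "(\<Sum>k\<in>I. (M k j)\<^sup>2) = (\<Sum>k\<in>I. M j k * M k j)"
    using ij(2) Asym Dsym by (intro sum.cong refl) (simp add: M_def power2_eq_square)
  also have "\<dots> = 0" using M0 ij(2) by simp
  finally have "M i j = 0" using I ij by (simp add: sum_nonneg_eq_0_iff)
  thus ?thesis by (simp add: M_def D_def)
qed

text \<open>The number of the group that contains the coordinate \<open>i\<close>; meaningful for \<open>i\<close> in the union of the groups.\<close>
definition group_of :: "nat \<Rightarrow> (nat \<Rightarrow> nat set) \<Rightarrow> nat \<Rightarrow> nat" where
  "group_of R B i = (THE k. k \<in> {1..R} \<and> i \<in> B k)"

context
  fixes p R :: nat and B :: "nat \<Rightarrow> nat set"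
  assumes B: "equal_groups p R B" and R: "R \<in> {1..p}" "R dvd p"
begin

lemma group_size_pos: "p div R > 0"
  using R by (auto elim!: dvdE)

lemma group_subset: "k \<in> {1..R} \<Longrightarrow> B k \<subseteq> {1..p}"
  using B unfolding equal_groups_def by blast

lemma card_group: "k \<in> {1..R} \<Longrightarrow> card (B k) = p div R"
  using B unfolding equal_groups_def by blast

lemma group_of_eq: "k \<in> {1..R} \<Longrightarrow> i \<in> B k \<Longrightarrow> group_of R B i = k"
  unfolding group_of_def using B
  by (intro the_equality) (unfold equal_groups_def disjoint_family_on_def, blast+)

lemma group_of:
  assumes "i \<in> {1..p}"
  shows "group_of R B i \<in> {1..R}" "i \<in> B (group_of R B i)"
proof -
  obtain k where "k \<in> {1..R}" "i \<in> B k"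
    using B assms unfolding equal_groups_def by blast
  thus "group_of R B i \<in> {1..R}" "i \<in> B (group_of R B i)"
    using group_of_eq by auto
qed

lemma group_eq: "k \<in> {1..R} \<Longrightarrow> B k = {i\<in>{1..p}. group_of R B i = k}"
  using group_of group_of_eq group_subset by blast

lemma group_cov_1:
  assumes "i \<in> {1..p}" "j \<in> {1..p}"
  shows "group_cov 1 R B i j = of_bool (group_of R B i = group_of R B j)"
proof -
  have "group_cov 1 R B i j
      = (\<Sum>k=1..R. of_bool (group_of R B i = k) * of_bool (group_of R B j = k) :: real)"
    unfolding group_cov_def using assms
    by (auto simp: group_eq indicator_def intro!: sum.cong)
  also have "\<dots> = (\<Sum>k=1..R. if group_of R B i = k then of_bool (group_of R B j = k) else 0)"
    by (intro sum.cong) auto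
  also have "\<dots> = of_bool (group_of R B i = group_of R B j)"
    using group_of[OF assms(1)] by (subst sum.delta') auto
  finally show ?thesis .
qed

lemma sum_over_groups:
  fixes f :: "nat \<Rightarrow> real"
  shows "(\<Sum>i=1..p. f (group_of R B i)) = real (p div R) * (\<Sum>k=1..R. f k)"
proof -
  have "(\<Sum>i=1..p. f (group_of R B i)) = (\<Sum>k=1..R. \<Sum>i | i \<in> {1..p} \<and> group_of R B i = k. f (group_of R B i))"
    by (intro sum.group[symmetric]) (use group_of in auto)
  also have "\<dots> = (\<Sum>k=1..R. \<Sum>i\<in>B k. f k)"
    by (intro sum.cong) (auto simp: group_eq)
  also have "\<dots> = real (p div R) * (\<Sum>k=1..R. f k)"
    by (simp add: card_group sum_distrib_left)
  finally show ?thesis .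
qed

lemma psd_sqrt_group_cov:
  assumes "i \<in> {1..p}" "j \<in> {1..p}"
  shows "psd_sqrt {1..p} (group_cov 1 R B) i j
    = of_bool (group_of R B i = group_of R B j) / sqrt (real (p div R))"
proof -
  have "psd_sqrt {1..p} (group_cov 1 R B) i j = group_cov 1 R B i j / sqrt (real (p div R))"
  proof (rule psd_sqrt_of_scaled_projection[OF _ _ _ _ _ assms])
    show "is_psd_sqrt {1..p} (group_cov 1 R B) (psd_sqrt {1..p} (group_cov 1 R B))"
      using R by (intro is_psd_sqrt_group_cov[OF B]) auto
    show "0 < real (p div R)" using group_size_pos by simp
    fix i j assume ij: "i \<in> {1..p}" "j \<in> {1..p}"
    show "group_cov 1 R B i j = group_cov 1 R B j i"
      unfolding group_cov_1[OF ij] group_cov_1[OF ij(2,1)] by auto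
    have "(\<Sum>k=1..p. group_cov 1 R B i k * group_cov 1 R B k j)
        = (\<Sum>k=1..p. of_bool (group_of R B i = group_of R B k) * of_bool (group_of R B k = group_of R B j))"
      using ij by (simp add: group_cov_1)
    also have "\<dots> = real (p div R) * (\<Sum>k=1..R. of_bool (group_of R B i = k) * of_bool (k = group_of R B j))"
      by (rule sum_over_groups)
    also have "(\<Sum>k=1..R. of_bool (group_of R B i = k) * of_bool (k = group_of R B j))
       = (\<Sum>k=1..R. if group_of R B i = k then of_bool (k = group_of R B j) else (0 :: real))"
      by (intro sum.cong) auto
    also have "\<dots> = of_bool (group_of R B i = group_of R B j)"
      using group_of[OF ij(1)] by (subst sum.delta') auto
    finally show "(\<Sum>k=1..p. group_cov 1 R B i k * group_cov 1 R B k j)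
        = real (p div R) * group_cov 1 R B i j"
      using ij by (simp add: group_cov_1)
  qed auto
  thus ?thesis using assms by (simp add: group_cov_1)
qed

end

text \<open>Normalized sums over disjoint groups are again independent standard normal variables.\<close>
lemma distr_gauss_group_sums:
  assumes I: "finite I" and K: "K \<noteq> {}" and sub: "\<And>k. k \<in> K \<Longrightarrow> B k \<subseteq> I"
    and disj: "disjoint_family_on B K" and card: "\<And>k. k \<in> K \<Longrightarrow> card (B k) = n" and n: "n > 0"
  shows "distr (gauss I) (Pi\<^sub>M K (\<lambda>_. borel)) (\<lambda>z. \<lambda>k\<in>K. (\<Sum>j\<in>B k. z j) / sqrt (real n)) = gauss K"
proof -
  interpret prob_space "gauss I" by (rule prob_space_gauss)
  have comp: "distr (gauss I) borel (\<lambda>z. z i) = std_normal_distribution" if "i \<in> I" for i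
  proof -
    have "distr (gauss I) borel (\<lambda>z. z i) = distr (gauss I) std_normal_distribution (\<lambda>z. z i)"
      by (intro distr_cong) auto
    thus ?thesis
      using distr_PiM_component[of I "\<lambda>_. std_normal_distribution" i] that prob_space_std_normal by simp
  qed
  have ind: "indep_vars (\<lambda>_. borel) (\<lambda>i z. z i) I"
  proof (cases "I = {}")
    case False
    have "distr (gauss I) (Pi\<^sub>M I (\<lambda>_. borel)) (\<lambda>z. \<lambda>i\<in>I. z i) = distr (gauss I) (gauss I) (\<lambda>z. z)"
      by (intro distr_cong) (auto simp: sets_gauss space_PiM PiE_def extensional_restrict)
    also have "\<dots> = Pi\<^sub>M I (\<lambda>i. distr (gauss I) borel (\<lambda>z. z i))"
      by (auto simp: distr_id comp intro!: PiM_cong)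
    finally show ?thesis
      using False by (subst indep_vars_iff_distr_eq_PiM') auto
  next
    case True
    thus ?thesis using K sub[of "SOME k. k \<in> K"] card[of "SOME k. k \<in> K"] n
      by (auto simp: some_in_eq)
  qed
  define W where "W k z = (\<Sum>j\<in>B k. z j) / sqrt (real n)" for k and z :: "nat \<Rightarrow> real"
  have Wm: "W k \<in> borel_measurable (gauss I)" if "k \<in> K" for k
    unfolding W_def using sub[OF that]
    by (intro borel_measurable_divide borel_measurable_sum) auto
  have "indep_vars (\<lambda>_. borel) (\<lambda>k z. (\<Sum>j\<in>B k. restrict z (B k) j) / sqrt (real n)) K"
    by (rule indep_vars_compose2[OF indep_vars_restrict[OF ind sub disj]]) auto
  also have "?this \<longleftrightarrow> indep_vars (\<lambda>_. borel) W K"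
    by (intro indep_vars_cong) (auto simp: W_def fun_eq_iff)
  finally have indW: "indep_vars (\<lambda>_. borel) W K" .
  have distrW: "distr (gauss I) borel (W k) = std_normal_distribution" if k: "k \<in> K" for k
  proof -
    have Bk: "finite (B k)" "B k \<noteq> {}"
      using card[OF k] n by (auto simp: card_gt_0_iff intro: card_ge_0_finite)
    have "distributed (gauss I) lborel (\<lambda>z. z j) (normal_density 0 1)" if "j \<in> B k" for j
    proof -
      have j: "j \<in> I" using sub k that by auto
      have "distr (gauss I) lborel (\<lambda>z. z j) = distr (gauss I) borel (\<lambda>z. z j)"
        by (intro distr_cong) auto
      thus ?thesis using comp[OF j] j
        by (simp add: distributed_def)
    qed
    with Bk have "distributed (gauss I) lborel (\<lambda>z. \<Sum>j\<in>B k. z j)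
        (normal_density (\<Sum>j\<in>B k. 0) (sqrt (\<Sum>j\<in>B k. 1\<^sup>2)))"
      using indep_vars_subset[OF ind sub[OF k]] by (intro sum_indep_normal) auto
    hence "distributed (gauss I) lborel (\<lambda>z. \<Sum>j\<in>B k. z j) (normal_density 0 (sqrt (real n)))"
      by (simp add: card[OF k])
    hence "distributed (gauss I) lborel (W k) std_normal_density"
      using n by (subst (asm) normal_standard_normal_convert) (auto simp: W_def[abs_def])
    hence "distr (gauss I) lborel (W k) = std_normal_distribution"
      by (simp add: distributed_def)
    moreover have "distr (gauss I) lborel (W k) = distr (gauss I) borel (W k)"
      by (intro distr_cong) auto
    ultimately show ?thesis by simp
  qed
  have "distr (gauss I) (Pi\<^sub>M K (\<lambda>_. borel)) (\<lambda>z. \<lambda>k\<in>K. W k z) = Pi\<^sub>M K (\<lambda>k. distr (gauss I) borel (W k))"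
    using indW K Wm by (subst (asm) indep_vars_iff_distr_eq_PiM') auto
  also have "\<dots> = gauss K"
    by (intro PiM_cong distrW) auto
  finally show ?thesis unfolding W_def .
qed

text \<open>At full correlation a group shares a single standard normal noise variable.\<close>
lemma obs_law_degenerate:
  assumes B: "equal_groups p R B" and R: "R \<in> {1..p}" "R dvd p"
  shows "obs_law p 1 R B \<theta>
    = distr (gauss {1..R}) (euclid {1..p}) (\<lambda>w. \<lambda>i\<in>{1..p}. \<theta> i + w (group_of R B i))"
proof -
  define n where "n = p div R"
  define W where "W z = (\<lambda>k\<in>{1..R}. (\<Sum>j\<in>B k. z j) / sqrt (real n))" for z :: "nat \<Rightarrow> real"
  have W: "distr (gauss {1..p}) (euclid {1..R}) W = gauss {1..R}"
    unfolding W_def using B R group_size_pos[OF B R]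
    by (intro distr_gauss_group_sums) (auto simp: equal_groups_def n_def)
  have Wm: "W \<in> gauss {1..p} \<rightarrow>\<^sub>M euclid {1..R}"
    unfolding W_def
  proof (intro measurable_restrict borel_measurable_divide borel_measurable_sum)
    fix k i assume k: "k \<in> {1..R}" and "i \<in> B k"
    hence [measurable]: "i \<in> {1..p}" using group_subset[OF B R k] by blast
    show "(\<lambda>z. z i) \<in> borel_measurable (gauss {1..p})" by measurable
  qed auto
  have Tm: "(\<lambda>w. \<lambda>i\<in>{1..p}. \<theta> i + w (group_of R B i)) \<in> euclid {1..R} \<rightarrow>\<^sub>M euclid {1..p}"
    using group_of[OF B R] by (intro measurable_restrict borel_measurable_add) auto
  have "distr (gauss {1..R}) (euclid {1..p}) (\<lambda>w. \<lambda>i\<in>{1..p}. \<theta> i + w (group_of R B i))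
      = distr (gauss {1..p}) (euclid {1..p}) ((\<lambda>w. \<lambda>i\<in>{1..p}. \<theta> i + w (group_of R B i)) \<circ> W)"
    unfolding W[symmetric] by (intro distr_distr Tm Wm)
  also have "\<dots> = obs_law p 1 R B \<theta>"
    unfolding obs_law_def multi_normal_def
  proof (intro distr_cong refl ext)
    fix z and i
    show "((\<lambda>w. \<lambda>i\<in>{1..p}. \<theta> i + w (group_of R B i)) \<circ> W) z i
        = (\<lambda>i\<in>{1..p}. \<theta> i + (\<Sum>j=1..p. psd_sqrt {1..p} (group_cov 1 R B) i j * z j)) i"
    proof (cases "i \<in> {1..p}")
      case True
      note g = group_of[OF B R True]
      have "(\<Sum>j=1..p. psd_sqrt {1..p} (group_cov 1 R B) i j * z j)
          = (\<Sum>j=1..p. if j \<in> B (group_of R B i) then z j / sqrt (real n) else 0)"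
      proof (intro sum.cong refl)
        fix j assume j: "j \<in> {1..p}"
        show "psd_sqrt {1..p} (group_cov 1 R B) i j * z j
            = (if j \<in> B (group_of R B i) then z j / sqrt (real n) else 0)"
          unfolding psd_sqrt_group_cov[OF B R True j] group_eq[OF B R g(1)] n_def using j by auto
      qed
      also have "\<dots> = (\<Sum>j\<in>B (group_of R B i). z j / sqrt (real n))"
        using group_subset[OF B R g(1)] by (intro sum.mono_neutral_cong_right) auto
      finally show ?thesis using True g by (simp add: W_def sum_divide_distrib)
    qed auto
  qed
  finally show ?thesis by simp
qed

section \<open>Reduction of the risk to the group means\<close>

lemma SUP_type_II_error_nonneg:
  assumes ne: "sparse_alternatives p s \<epsilon> \<noteq> {}" and prob: "\<And>\<theta>. prob_space (obs_law p \<gamma> R B \<theta>)"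
  shows "0 \<le> (SUP \<theta> \<in> sparse_alternatives p s \<epsilon>. measure (obs_law p \<gamma> R B \<theta>) A)"
proof -
  obtain \<theta> where \<theta>: "\<theta> \<in> sparse_alternatives p s \<epsilon>" using ne by blast
  have "0 \<le> measure (obs_law p \<gamma> R B \<theta>) A" by simp
  also have "\<dots> \<le> (SUP \<theta> \<in> sparse_alternatives p s \<epsilon>. measure (obs_law p \<gamma> R B \<theta>) A)"
    using prob_space.prob_le_1[OF prob] by (intro cSUP_upper \<theta> bdd_aboveI2[where M = 1])
  finally show ?thesis .
qed

lemma minimax_risk_nonneg:
  assumes "sparse_alternatives p s \<epsilon> \<noteq> {}" "\<And>\<theta>. prob_space (obs_law p \<gamma> R B \<theta>)"
  shows "0 \<le> minimax_risk p s \<gamma> R B \<epsilon>"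
  unfolding minimax_risk_def
  by (intro cINF_greatest add_nonneg_nonneg SUP_type_II_error_nonneg assms)
    (auto intro!: exI[of _ "\<lambda>_. 0"] simp: ex_in_conv[symmetric])

lemma minimax_risk_le:
  assumes ne: "sparse_alternatives p s \<epsilon> \<noteq> {}" and prob: "\<And>\<theta>. prob_space (obs_law p \<gamma> R B \<theta>)"
    and \<phi>: "\<phi> \<in> euclid {1..p} \<rightarrow>\<^sub>M count_space {0, 1 :: nat}"
    and a: "measure (obs_law p \<gamma> R B (\<lambda>i\<in>{1..p}. 0)) {x \<in> space (euclid {1..p}). \<phi> x = 1} \<le> a"
    and b: "\<And>\<theta>. \<theta> \<in> sparse_alternatives p s \<epsilon> \<Longrightarrow>
      measure (obs_law p \<gamma> R B \<theta>) {x \<in> space (euclid {1..p}). \<phi> x = 0} \<le> b"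
  shows "minimax_risk p s \<gamma> R B \<epsilon> \<le> a + b"
proof -
  have "minimax_risk p s \<gamma> R B \<epsilon>
      \<le> measure (obs_law p \<gamma> R B (\<lambda>i\<in>{1..p}. 0)) {x \<in> space (euclid {1..p}). \<phi> x = 1} +
        (SUP \<theta> \<in> sparse_alternatives p s \<epsilon>.
           measure (obs_law p \<gamma> R B \<theta>) {x \<in> space (euclid {1..p}). \<phi> x = 0})"
    unfolding minimax_risk_def
    by (rule cINF_lower[OF _ \<phi>])
      (intro bdd_belowI2[where m = 0] add_nonneg_nonneg SUP_type_II_error_nonneg ne prob measure_nonneg)
  also have "\<dots> \<le> a + b"
    using a b ne by (intro add_mono cSUP_least) auto
  finally show ?thesis .
qed

text \<open>The maximal type II error is at least the average over finitely many alternatives (a Bayes risk).\<close>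
lemma minimax_risk_ge:
  assumes prob: "\<And>\<theta>. prob_space (obs_law p \<gamma> R B \<theta>)"
    and F: "finite F" "F \<noteq> {}" and \<theta>: "\<And>f. f \<in> F \<Longrightarrow> \<theta> f \<in> sparse_alternatives p s \<epsilon>"
    and le: "\<And>\<phi>. \<phi> \<in> euclid {1..p} \<rightarrow>\<^sub>M count_space {0, 1 :: nat} \<Longrightarrow>
      c \<le> measure (obs_law p \<gamma> R B (\<lambda>i\<in>{1..p}. 0)) {x \<in> space (euclid {1..p}). \<phi> x = 1} +
        (\<Sum>f\<in>F. measure (obs_law p \<gamma> R B (\<theta> f)) {x \<in> space (euclid {1..p}). \<phi> x = 0}) / real (card F)"
  shows "c \<le> minimax_risk p s \<gamma> R B \<epsilon>"
  unfolding minimax_risk_def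
proof (rule cINF_greatest)
  show "euclid {1..p} \<rightarrow>\<^sub>M count_space {0, 1 :: nat} \<noteq> {}"
    by (auto intro!: exI[of _ "\<lambda>_. 0"] simp: ex_in_conv[symmetric])
next
  fix \<phi> :: "(nat \<Rightarrow> real) \<Rightarrow> nat" assume \<phi>: "\<phi> \<in> euclid {1..p} \<rightarrow>\<^sub>M count_space {0, 1}"
  define E where "E \<theta> = measure (obs_law p \<gamma> R B \<theta>) {x \<in> space (euclid {1..p}). \<phi> x = 0}" for \<theta>
  have "(\<Sum>f\<in>F. E (\<theta> f)) \<le> (\<Sum>f\<in>F. SUP \<theta> \<in> sparse_alternatives p s \<epsilon>. E \<theta>)"
    unfolding E_def using prob_space.prob_le_1[OF prob]
    by (intro sum_mono cSUP_upper \<theta> bdd_aboveI2[where M = 1])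
  hence "(\<Sum>f\<in>F. E (\<theta> f)) / real (card F) \<le> (SUP \<theta> \<in> sparse_alternatives p s \<epsilon>. E \<theta>)"
    using F by (simp add: pos_divide_le_eq card_gt_0_iff mult.commute)
  with le[OF \<phi>]
  show "c \<le> measure (obs_law p \<gamma> R B (\<lambda>i\<in>{1..p}. 0)) {x \<in> space (euclid {1..p}). \<phi> x = 1} +
      (SUP \<theta> \<in> sparse_alternatives p s \<epsilon>. measure (obs_law p \<gamma> R B \<theta>) {x \<in> space (euclid {1..p}). \<phi> x = 0})"
    unfolding E_def by linarith
qed

lemma sparse_alternatives_nonempty:
  assumes "s \<in> {1..p}"
  shows "sparse_alternatives p s \<epsilon> \<noteq> {}"
proof -
  define \<theta> where "\<theta> = (\<lambda>i\<in>{1..p}. if i = 1 then \<bar>\<epsilon>\<bar> else 0)"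
  have "L2_set \<theta> {1..p} \<ge> \<epsilon>"
  proof -
    have "(\<Sum>i=1..p. (\<theta> i)\<^sup>2) = (\<Sum>i\<in>{1}. (\<theta> i)\<^sup>2)"
      using assms by (intro sum.mono_neutral_right) (auto simp: \<theta>_def)
    thus ?thesis using assms by (simp add: L2_set_def \<theta>_def)
  qed
  moreover have "card {i\<in>{1..p}. \<theta> i \<noteq> 0} \<le> card {1 :: nat}"
    by (intro card_mono) (auto simp: \<theta>_def)
  ultimately have "\<theta> \<in> sparse_alternatives p s \<epsilon>"
    using assms by (auto simp: sparse_alternatives_def \<theta>_def space_PiM)
  thus ?thesis by blast
qed

context
  fixes p R :: nat and B :: "nat \<Rightarrow> nat set"
  assumes B: "equal_groups p R B" and R: "R \<in> {1..p}" "R dvd p"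
begin

lemma measurable_group_lift:
  "(\<lambda>w. \<lambda>i\<in>{1..p}. \<theta> i + w (group_of R B i)) \<in> gauss {1..R} \<rightarrow>\<^sub>M euclid {1..p}"
  using group_of[OF B R] by (intro measurable_restrict borel_measurable_add) auto

lemma prob_space_obs_law: "prob_space (obs_law p 1 R B \<theta>)"
  unfolding obs_law_degenerate[OF B R]
  by (intro prob_space.prob_space_distr prob_space_gauss measurable_group_lift)

lemma measure_obs_law:
  assumes \<phi>: "\<phi> \<in> euclid {1..p} \<rightarrow>\<^sub>M count_space {0, 1 :: nat}"
  shows "measure (obs_law p 1 R B \<theta>) {x \<in> space (euclid {1..p}). \<phi> x = c}
    = measure (gauss {1..R}) {w \<in> space (gauss {1..R}). \<phi> (\<lambda>i\<in>{1..p}. \<theta> i + w (group_of R B i)) = c}"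
proof -
  have \<phi>': "\<phi> \<in> euclid {1..p} \<rightarrow>\<^sub>M count_space UNIV"
    by (rule measurable_compose[OF \<phi>]) simp
  have "{x \<in> space (euclid {1..p}). \<phi> x = c} \<in> sets (euclid {1..p})"
    using measurable_sets[OF \<phi>', of "{c}"] by (simp add: vimage_def Int_def conj_commute)
  thus ?thesis
    unfolding obs_law_degenerate[OF B R]
    using measurable_space[OF measurable_group_lift]
    by (subst measure_distr[OF measurable_group_lift]) (auto intro!: arg_cong[where f = "measure _"])
qed

text \<open>
  A mean vector that is constant on the groups is a vector \<open>\<mu>\<close> of \<open>R\<close> group means; each of them
  counts \<open>p div R\<close> times in the sparsity and in the squared norm.
\<close>
lemma group_lift_in_sparse_alternatives_iff:
  assumes \<theta>: "\<theta> \<in> space (euclid {1..p})" "\<And>i. i \<in> {1..p} \<Longrightarrow> \<theta> i = \<mu> (group_of R B i)" and \<epsilon>: "0 \<le> \<epsilon>"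
  shows "\<theta> \<in> sparse_alternatives p s \<epsilon> \<longleftrightarrow>
    card {k\<in>{1..R}. \<mu> k \<noteq> 0} * (p div R) \<le> s \<and> \<epsilon>\<^sup>2 \<le> real (p div R) * (\<Sum>k=1..R. (\<mu> k)\<^sup>2)"
proof -
  have "(\<Sum>i=1..p. (\<theta> i)\<^sup>2) = (\<Sum>i=1..p. (\<mu> (group_of R B i))\<^sup>2)"
    using \<theta>(2) by (intro sum.cong) auto
  also have "\<dots> = real (p div R) * (\<Sum>k=1..R. (\<mu> k)\<^sup>2)"
    by (rule sum_over_groups[OF B R])
  finally have "L2_set \<theta> {1..p} \<ge> \<epsilon> \<longleftrightarrow> \<epsilon>\<^sup>2 \<le> real (p div R) * (\<Sum>k=1..R. (\<mu> k)\<^sup>2)"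
    using real_sqrt_le_iff[of "\<epsilon>\<^sup>2"] \<epsilon> by (simp add: L2_set_def)
  moreover have "real (card {i\<in>{1..p}. \<theta> i \<noteq> 0}) = real (card {k\<in>{1..R}. \<mu> k \<noteq> 0} * (p div R))"
  proof -
    have c: "real (card {i\<in>A. P i}) = (\<Sum>i\<in>A. of_bool (P i))" if "finite A" for A :: "nat set" and P
      using that by (simp add: of_bool_def sum.If_cases Int_def)
    have "real (card {i\<in>{1..p}. \<theta> i \<noteq> 0}) = (\<Sum>i=1..p. of_bool (\<mu> (group_of R B i) \<noteq> 0))"
      unfolding c[OF finite_atLeastAtMost] using \<theta>(2) by (intro sum.cong) auto
    also have "\<dots> = real (p div R) * (\<Sum>k=1..R. of_bool (\<mu> k \<noteq> 0))"
      by (rule sum_over_groups[OF B R])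
    finally show ?thesis
      unfolding c[OF finite_atLeastAtMost, symmetric] by (simp add: mult.commute)
  qed
  ultimately show ?thesis
    using \<theta>(1) unfolding sparse_alternatives_def of_nat_eq_iff by auto
qed

text \<open>
  The test rejects if the observation is not constant on some group, which never happens for a
  group-constant mean and always happens for any other mean, or if the statistic \<open>T\<close> of the common
  values of the groups exceeds \<open>\<tau>\<close>. Only group-constant means contribute to the type II error.
\<close>
lemma minimax_risk_le_of_group_test:
  fixes T :: "(nat \<Rightarrow> real) \<Rightarrow> real"
  assumes s: "s \<in> {1..p}" and \<epsilon>: "0 \<le> \<epsilon>"
    and T: "T \<in> borel_measurable (euclid {1..R})"
    and null: "measure (gauss {1..R}) {w \<in> space (gauss {1..R}). \<tau> < T w} \<le> a"
    and alt: "\<And>\<mu>. card {k\<in>{1..R}. \<mu> k \<noteq> 0} * (p div R) \<le> s \<Longrightarrow>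
      \<epsilon>\<^sup>2 \<le> real (p div R) * (\<Sum>k=1..R. (\<mu> k)\<^sup>2) \<Longrightarrow>
      measure (gauss {1..R}) {w \<in> space (gauss {1..R}). T (\<lambda>k\<in>{1..R}. w k + \<mu> k) \<le> \<tau>} \<le> b"
    and b: "0 \<le> b"
  shows "minimax_risk p s 1 R B \<epsilon> \<le> a + b"
proof -
  define g where "g = group_of R B"
  \<comment> \<open>A representative of each group, at which the common value is read off.\<close>
  define rep where "rep k = (SOME i. i \<in> B k)" for k
  have rep: "rep k \<in> {1..p}" "g (rep k) = k" if "k \<in> {1..R}" for k
  proof -
    have "B k \<noteq> {}"
      using card_group[OF B R that] group_size_pos[OF B R] by auto
    hence "rep k \<in> B k" unfolding rep_def by (rule some_in_eq[THEN iffD2])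
    thus "rep k \<in> {1..p}" "g (rep k) = k"
      using group_subset[OF B R that] group_of_eq[OF B R that] by (auto simp: g_def)
  qed
  have gR: "g i \<in> {1..R}" if "i \<in> {1..p}" for i
    using group_of[OF B R that] by (simp add: g_def)
  define const where "const x \<longleftrightarrow> (\<forall>i\<in>{1..p}. \<forall>j\<in>{1..p}. g i = g j \<longrightarrow> x i = x j)" for x :: "nat \<Rightarrow> real"
  define r where "r x = (\<lambda>k\<in>{1..R}. x (rep k))" for x :: "nat \<Rightarrow> real"
  define \<phi> where "\<phi> x = (if const x \<and> T (r x) \<le> \<tau> then 0 else 1 :: nat)" for x
  have r: "r \<in> euclid {1..p} \<rightarrow>\<^sub>M euclid {1..R}"
    unfolding r_def by (rule measurable_restrict) (erule measurable_component_singleton[OF rep(1)])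
  have \<phi>: "\<phi> \<in> euclid {1..p} \<rightarrow>\<^sub>M count_space {0, 1}"
  proof -
    have "Measurable.pred (euclid {1..p}) const"
      unfolding const_def
    proof (intro pred_intros_finite(3) pred_intros_imp' finite_atLeastAtMost)
      fix i j assume ij: "i \<in> {1..p}" "j \<in> {1..p}"
      have [measurable]: "(\<lambda>x. x i) \<in> borel_measurable (euclid {1..p})"
        "(\<lambda>x. x j) \<in> borel_measurable (euclid {1..p})"
        by (rule measurable_component_singleton, rule ij)+
      show "Measurable.pred (euclid {1..p}) (\<lambda>x. x i = x j)"
        unfolding pred_def by (rule borel_measurable_eq) measurable
    qed
    moreover have "Measurable.pred (euclid {1..p}) (\<lambda>x. T (r x) \<le> \<tau>)"
      unfolding pred_def by (rule borel_measurable_le[OF measurable_compose[OF r T]]) simp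
    ultimately show ?thesis
      unfolding \<phi>_def by (intro measurable_If_set measurable_If) (auto simp: measurable_const)
  qed
  show ?thesis
  proof (rule minimax_risk_le[OF sparse_alternatives_nonempty[OF s] prob_space_obs_law \<phi>])
    have "measure (obs_law p 1 R B (\<lambda>i\<in>{1..p}. 0)) {x \<in> space (euclid {1..p}). \<phi> x = 1}
        = measure (gauss {1..R}) {w \<in> space (gauss {1..R}). \<tau> < T w}"
      unfolding measure_obs_law[OF \<phi>] g_def[symmetric]
    proof (intro arg_cong[where f = "measure _"] Collect_cong conj_cong refl)
      fix w assume w: "w \<in> space (gauss {1..R})"
      define x where "x = (\<lambda>i\<in>{1..p}. (\<lambda>i\<in>{1..p}. 0) i + w (g i))"
      have "const x" unfolding const_def x_def by auto
      moreover have "r x = w"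
        using w rep by (auto simp: r_def x_def space_PiM PiE_def extensional_def fun_eq_iff)
      ultimately show "\<phi> (\<lambda>i\<in>{1..p}. (\<lambda>i\<in>{1..p}. 0) i + w (g i)) = 1 \<longleftrightarrow> \<tau> < T w"
        unfolding x_def[symmetric] by (auto simp: \<phi>_def)
    qed
    thus "measure (obs_law p 1 R B (\<lambda>i\<in>{1..p}. 0)) {x \<in> space (euclid {1..p}). \<phi> x = 1} \<le> a"
      using null by simp
  next
    fix \<theta> assume \<theta>: "\<theta> \<in> sparse_alternatives p s \<epsilon>"
    show "measure (obs_law p 1 R B \<theta>) {x \<in> space (euclid {1..p}). \<phi> x = 0} \<le> b"
    proof (cases "const \<theta>")
      case False
      then obtain i j where ij: "i \<in> {1..p}" "j \<in> {1..p}" "g i = g j" "\<theta> i \<noteq> \<theta> j"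
        by (auto simp: const_def)
      have "\<not> const (\<lambda>i\<in>{1..p}. \<theta> i + w (g i))" for w
      proof
        assume "const (\<lambda>i\<in>{1..p}. \<theta> i + w (g i))"
        hence "(\<lambda>i\<in>{1..p}. \<theta> i + w (g i)) i = (\<lambda>i\<in>{1..p}. \<theta> i + w (g i)) j"
          using ij(1-3) unfolding const_def by blast
        thus False using ij by simp
      qed
      hence "{w \<in> space (gauss {1..R}). \<phi> (\<lambda>i\<in>{1..p}. \<theta> i + w (g i)) = 0} = {}"
        by (auto simp: \<phi>_def)
      thus ?thesis unfolding measure_obs_law[OF \<phi>] g_def[symmetric] using b by (simp only: measure_empty)
    next
      case True
      define \<mu> where "\<mu> k = \<theta> (rep k)" for k
      have \<theta>\<mu>: "\<theta> i = \<mu> (group_of R B i)" if "i \<in> {1..p}" for i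
        using True rep[OF gR[OF that]] that unfolding const_def \<mu>_def g_def by metis
      have sp: "\<theta> \<in> space (euclid {1..p})" using \<theta> by (simp add: sparse_alternatives_def)
      have "measure (obs_law p 1 R B \<theta>) {x \<in> space (euclid {1..p}). \<phi> x = 0}
        = measure (gauss {1..R}) {w \<in> space (gauss {1..R}). T (\<lambda>k\<in>{1..R}. w k + \<mu> k) \<le> \<tau>}"
        unfolding measure_obs_law[OF \<phi>] g_def[symmetric]
      proof (intro arg_cong[where f = "measure _"] Collect_cong conj_cong refl)
        fix w assume w: "w \<in> space (gauss {1..R})"
        define x where "x = (\<lambda>i\<in>{1..p}. \<theta> i + w (g i))"
        have "const x"
          unfolding const_def
        proof (intro ballI impI)
          fix i j assume ij: "i \<in> {1..p}" "j \<in> {1..p}" "g i = g j"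
          hence "\<theta> i = \<theta> j" using True unfolding const_def by blast
          thus "x i = x j" using ij by (simp add: x_def)
        qed
        moreover have "r x = (\<lambda>k\<in>{1..R}. w k + \<mu> k)"
          using w rep by (auto simp: r_def x_def \<mu>_def fun_eq_iff)
        ultimately show "\<phi> (\<lambda>i\<in>{1..p}. \<theta> i + w (g i)) = 0 \<longleftrightarrow> T (\<lambda>k\<in>{1..R}. w k + \<mu> k) \<le> \<tau>"
          unfolding x_def[symmetric] by (auto simp: \<phi>_def)
      qed
      also have "\<dots> \<le> b"
        using \<theta> group_lift_in_sparse_alternatives_iff[OF sp \<theta>\<mu> \<epsilon>] by (intro alt) auto
      finally show ?thesis .
    qed
  qed
qed

lemma minimax_risk_ge_of_group_prior:
  fixes \<mu> :: "'f \<Rightarrow> nat \<Rightarrow> real"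
  assumes \<epsilon>: "0 \<le> \<epsilon>" and F: "finite F" "F \<noteq> {}" and \<delta>: "\<delta> > 0"
    and sparse: "\<And>f. f \<in> F \<Longrightarrow> card {k\<in>{1..R}. \<mu> f k \<noteq> 0} * (p div R) \<le> s"
    and norm: "\<And>f. f \<in> F \<Longrightarrow> \<epsilon>\<^sup>2 \<le> real (p div R) * (\<Sum>k=1..R. (\<mu> f k)\<^sup>2)"
    and bound: "(\<Sum>f\<in>F. \<Sum>g\<in>F. exp (\<Sum>k=1..R. \<mu> f k * \<mu> g k)) \<le> (1 + \<delta>\<^sup>2) * (real (card F))\<^sup>2"
  shows "1 - \<delta> \<le> minimax_risk p s 1 R B \<epsilon>"
proof (rule minimax_risk_ge[OF prob_space_obs_law F])
  define \<theta> where "\<theta> f = (\<lambda>i\<in>{1..p}. \<mu> f (group_of R B i))" for f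
  show "\<theta> f \<in> sparse_alternatives p s \<epsilon>" if "f \<in> F" for f
  proof (rule group_lift_in_sparse_alternatives_iff[THEN iffD2])
    show "\<theta> f \<in> space (euclid {1..p})" by (auto simp: \<theta>_def space_PiM)
  qed (use sparse norm that \<epsilon> in \<open>auto simp: \<theta>_def\<close>)
  fix \<phi> :: "(nat \<Rightarrow> real) \<Rightarrow> nat" assume \<phi>: "\<phi> \<in> euclid {1..p} \<rightarrow>\<^sub>M count_space {0, 1}"
  interpret prob_space "gauss {1..R}" by (rule prob_space_gauss)
  define x where "x w = (\<lambda>i\<in>{1..p}. (\<lambda>i\<in>{1..p}. 0) i + w (group_of R B i))" for w :: "nat \<Rightarrow> real"
  have xm: "x \<in> gauss {1..R} \<rightarrow>\<^sub>M euclid {1..p}"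
    unfolding x_def by (rule measurable_group_lift)
  define A where "A = {w \<in> space (gauss {1..R}). \<phi> (x w) = 0}"
  have A: "A \<in> sets (gauss {1..R})"
    using measurable_sets[OF measurable_compose[OF xm \<phi>], of "{0}"]
    by (simp add: A_def vimage_def Int_def conj_commute)
  have val: "\<phi> (x w) = 1 \<longleftrightarrow> \<phi> (x w) \<noteq> 0" if "w \<in> space (gauss {1..R})" for w
    using measurable_space[OF \<phi> measurable_space[OF xm that]] by auto
  have "measure (obs_law p 1 R B (\<lambda>i\<in>{1..p}. 0)) {x \<in> space (euclid {1..p}). \<phi> x = 1}
      = prob (space (gauss {1..R}) - A)"
    unfolding measure_obs_law[OF \<phi>] x_def[symmetric] using val
    by (intro arg_cong[where f = prob]) (auto simp: A_def)
  also have "\<dots> = 1 - prob A" by (rule prob_compl[OF A])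
  finally have null: "measure (obs_law p 1 R B (\<lambda>i\<in>{1..p}. 0)) {x \<in> space (euclid {1..p}). \<phi> x = 1} = 1 - prob A" .
  have alt: "measure (obs_law p 1 R B (\<theta> f)) {x \<in> space (euclid {1..p}). \<phi> x = 0}
      = prob {w \<in> space (gauss {1..R}). (\<lambda>k\<in>{1..R}. w k + \<mu> f k) \<in> A}" for f
    unfolding measure_obs_law[OF \<phi>]
  proof (intro arg_cong[where f = prob] Collect_cong conj_cong refl)
    fix w assume w: "w \<in> space (gauss {1..R})"
    have "(\<lambda>i\<in>{1..p}. \<theta> f i + w (group_of R B i)) = x (\<lambda>k\<in>{1..R}. w k + \<mu> f k)"
      using group_of(1)[OF B R] by (auto simp: x_def \<theta>_def fun_eq_iff add.commute)
    moreover have "(\<lambda>k\<in>{1..R}. w k + \<mu> f k) \<in> space (gauss {1..R})"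
      by (auto simp: space_PiM)
    ultimately show "\<phi> (\<lambda>i\<in>{1..p}. \<theta> f i + w (group_of R B i)) = 0 \<longleftrightarrow> (\<lambda>k\<in>{1..R}. w k + \<mu> f k) \<in> A"
      by (simp add: A_def)
  qed
  show "1 - \<delta> \<le> measure (obs_law p 1 R B (\<lambda>i\<in>{1..p}. 0)) {x \<in> space (euclid {1..p}). \<phi> x = 1} +
      (\<Sum>f\<in>F. measure (obs_law p 1 R B (\<theta> f)) {x \<in> space (euclid {1..p}). \<phi> x = 0}) / real (card F)"
    unfolding null alt using gauss_shifted_mixture_bound[OF _ F A \<delta> bound] by simp
qed

end

section \<open>The chi-square test\<close>

lemma gauss_chi_square_deviation:
  assumes I: "finite I" "I \<noteq> {}" and K: "K > 0"
  shows "measure (gauss I) {w \<in> space (gauss I).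
      K * sqrt (card I) \<le> \<bar>(\<Sum>k\<in>I. (w k)\<^sup>2) - card I\<bar>} \<le> 3 / K\<^sup>2"
proof -
  have R: "real (card I) > 0" using I by (simp add: card_gt_0_iff)
  have "measure (gauss I) {w \<in> space (gauss I).
      K * sqrt (card I) \<le> \<bar>(\<Sum>k\<in>I. (w k)\<^sup>2) - (\<Sum>k\<in>I. \<integral>x. x\<^sup>2 \<partial>std_normal_distribution)\<bar>}
    \<le> (\<Sum>k\<in>I. \<integral>x. (x\<^sup>2)\<^sup>2 \<partial>std_normal_distribution) / (K * sqrt (card I))\<^sup>2"
    using I R K integrable_std_normal_distribution_moment[of 4]
    by (intro gauss_sum_Chebyshev) auto
  thus ?thesis
    using R K by (simp only: std_normal_moments) (simp add: power_mult_distrib field_simps)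
qed

lemma gauss_linear_deviation:
  assumes I: "finite I" and K: "K > 0" and \<mu>: "(\<Sum>k\<in>I. (\<mu> k)\<^sup>2) > 0"
  shows "measure (gauss I) {w \<in> space (gauss I).
      K * sqrt (\<Sum>k\<in>I. (\<mu> k)\<^sup>2) \<le> \<bar>\<Sum>k\<in>I. \<mu> k * w k\<bar>} \<le> 1 / K\<^sup>2"
proof -
  have "measure (gauss I) {w \<in> space (gauss I). K * sqrt (\<Sum>k\<in>I. (\<mu> k)\<^sup>2)
      \<le> \<bar>(\<Sum>k\<in>I. \<mu> k * w k) - (\<Sum>k\<in>I. \<integral>x. \<mu> k * x \<partial>std_normal_distribution)\<bar>}
    \<le> (\<Sum>k\<in>I. \<integral>x. (\<mu> k * x)\<^sup>2 \<partial>std_normal_distribution) / (K * sqrt (\<Sum>k\<in>I. (\<mu> k)\<^sup>2))\<^sup>2"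
    using I \<mu> K integrable_std_normal_distribution_moment[of 2]
    by (intro gauss_sum_Chebyshev) (auto simp: power_mult_distrib)
  thus ?thesis
    using \<mu> K by (simp add: std_normal_moments power_mult_distrib)
qed

lemma chi_square_type_I:
  assumes I: "finite I" "I \<noteq> {}" and K: "K > 0"
  shows "measure (gauss I) {w \<in> space (gauss I). card I + K * sqrt (card I) < (\<Sum>k\<in>I. (w k)\<^sup>2)} \<le> 3 / K\<^sup>2"
proof -
  interpret prob_space "gauss I" by (rule prob_space_gauss)
  have "prob {w \<in> space (gauss I). card I + K * sqrt (card I) < (\<Sum>k\<in>I. (w k)\<^sup>2)}
      \<le> prob {w \<in> space (gauss I). K * sqrt (card I) \<le> \<bar>(\<Sum>k\<in>I. (w k)\<^sup>2) - card I\<bar>}"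
    by (intro finite_measure_mono) auto
  also have "\<dots> \<le> 3 / K\<^sup>2" by (rule gauss_chi_square_deviation[OF I K])
  finally show ?thesis .
qed

text \<open>
  The shift changes the sum of squares by \<open>\<parallel>\<mu>\<parallel>\<^sup>2\<close> and by twice a linear form of
  standard deviation \<open>\<parallel>\<mu>\<parallel>\<close>.
\<close>
lemma chi_square_type_II:
  assumes I: "finite I" "I \<noteq> {}" and K: "K \<ge> 1"
    and \<mu>: "(4 * K)\<^sup>2 * sqrt (card I) \<le> (\<Sum>k\<in>I. (\<mu> k)\<^sup>2)"
  shows "measure (gauss I) {w \<in> space (gauss I).
      (\<Sum>k\<in>I. ((\<lambda>k\<in>I. w k + \<mu> k) k)\<^sup>2) \<le> card I + K * sqrt (card I)} \<le> 4 / K\<^sup>2"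
proof -
  interpret prob_space "gauss I" by (rule prob_space_gauss)
  define R where "R = real (card I)"
  have R: "R \<ge> 1" using I by (simp add: R_def card_gt_0_iff Suc_le_eq)
  hence sR: "sqrt R \<ge> 1" by simp
  define M where "M = sqrt (\<Sum>k\<in>I. (\<mu> k)\<^sup>2)"
  have M2: "M\<^sup>2 = (\<Sum>k\<in>I. (\<mu> k)\<^sup>2)" by (simp add: M_def sum_nonneg)
  have M0: "M \<ge> 0" by (simp add: M_def sum_nonneg)
  have M2_ge: "(4 * K)\<^sup>2 * sqrt R \<le> M\<^sup>2" using \<mu> by (simp add: M2 R_def)
  have "(4 * K)\<^sup>2 * 1 \<le> (4 * K)\<^sup>2 * sqrt R" using sR by (intro mult_left_mono) auto
  with M2_ge have "(4 * K)\<^sup>2 \<le> M\<^sup>2" by linarith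
  hence M: "4 * K \<le> M" using M0 by (rule power2_le_imp_le)
  have pos: "(\<Sum>k\<in>I. (\<mu> k)\<^sup>2) > 0" using M K by (simp add: M2[symmetric])
  have gap: "2 * K * M + 2 * K * sqrt R \<le> M\<^sup>2"
  proof -
    have "4 * K * M \<le> M * M" using M M0 by (intro mult_right_mono) auto
    moreover have "4 * K * sqrt R \<le> (4 * K)\<^sup>2 * sqrt R"
      using K sR by (intro mult_right_mono) (auto simp: power2_eq_square)
    ultimately show ?thesis using M2_ge by (simp add: power2_eq_square)
  qed
  define A where "A = {w \<in> space (gauss I). K * sqrt R \<le> \<bar>(\<Sum>k\<in>I. (w k)\<^sup>2) - R\<bar>}"
  define B where "B = {w \<in> space (gauss I). K * M \<le> \<bar>\<Sum>k\<in>I. \<mu> k * w k\<bar>}"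
  have AB: "A \<in> sets (gauss I)" "B \<in> sets (gauss I)" unfolding A_def B_def by measurable
  have "prob {w \<in> space (gauss I). (\<Sum>k\<in>I. ((\<lambda>k\<in>I. w k + \<mu> k) k)\<^sup>2) \<le> R + K * sqrt R} \<le> prob (A \<union> B)"
  proof (intro finite_measure_mono subsetI)
    fix w assume w: "w \<in> {w \<in> space (gauss I). (\<Sum>k\<in>I. ((\<lambda>k\<in>I. w k + \<mu> k) k)\<^sup>2) \<le> R + K * sqrt R}"
    have "(\<Sum>k\<in>I. ((\<lambda>k\<in>I. w k + \<mu> k) k)\<^sup>2) = (\<Sum>k\<in>I. (w k)\<^sup>2) + 2 * (\<Sum>k\<in>I. \<mu> k * w k) + M\<^sup>2"
      unfolding M2 by (simp add: power2_sum sum.distrib sum_distrib_left mult_ac)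
    hence "(\<Sum>k\<in>I. (w k)\<^sup>2) - R + 2 * (\<Sum>k\<in>I. \<mu> k * w k) + M\<^sup>2 \<le> K * sqrt R" using w by auto
    hence "K * sqrt R \<le> \<bar>(\<Sum>k\<in>I. (w k)\<^sup>2) - R\<bar> \<or> K * M \<le> \<bar>\<Sum>k\<in>I. \<mu> k * w k\<bar>"
      using gap by linarith
    thus "w \<in> A \<union> B" using w by (auto simp: A_def B_def)
  qed (use AB in auto)
  also have "\<dots> \<le> prob A + prob B" using AB by (rule measure_Un_le)
  also have "\<dots> \<le> 3 / K\<^sup>2 + 1 / K\<^sup>2"
    unfolding A_def B_def M_def R_def using K
    by (intro add_mono gauss_chi_square_deviation gauss_linear_deviation I pos) auto
  finally show ?thesis by (simp add: R_def)
qed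

section \<open>The test for sparse shifts\<close>

text \<open>
  Since \<open>u\<^sup>4 \<le> 24 exp (t u)\<close> for \<open>u \<ge> 0\<close> and \<open>t \<ge> 1\<close>, the fourth moment of the excess over \<open>t\<close>
  is controlled by the moment generating function at \<open>t\<close> and \<open>- t\<close>.
\<close>
lemma std_normal_excess_moment:
  assumes t: "t \<ge> 1"
  shows "integrable std_normal_distribution (\<lambda>z. ((max (\<bar>z\<bar> - t) 0)\<^sup>2)\<^sup>2)"
    and "(\<integral>z. ((max (\<bar>z\<bar> - t) 0)\<^sup>2)\<^sup>2 \<partial>std_normal_distribution) \<le> 48 * exp (- t\<^sup>2 / 2)"
proof -
  define F where "F z = 24 * exp (- t\<^sup>2) * (exp (t * z) + exp ((- t) * z))" for z :: real
  have intF: "integrable std_normal_distribution F"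
    unfolding F_def using std_normal_mgf(1)[of t] std_normal_mgf(1)[of "- t"] by simp
  have "(\<integral>z. F z \<partial>std_normal_distribution) = 24 * exp (- t\<^sup>2) * (exp (t\<^sup>2 / 2) + exp ((- t)\<^sup>2 / 2))"
    unfolding F_def using std_normal_mgf[of t] std_normal_mgf[of "- t"] by simp
  also have "\<dots> = 48 * (exp (- t\<^sup>2) * exp (t\<^sup>2 / 2))"
    by simp
  also have "\<dots> = 48 * exp (- t\<^sup>2 / 2)"
    unfolding exp_add[symmetric] by simp
  finally have F: "(\<integral>z. F z \<partial>std_normal_distribution) = 48 * exp (- t\<^sup>2 / 2)" .
  have pow4: "x ^ 4 \<le> 24 * exp x" if "x \<ge> 0" for x :: real
  proof -
    have "x ^ 4 / fact 4 \<le> (\<Sum>n<5. x ^ n / fact n)"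
      using that by (intro member_le_sum) auto
    also have "\<dots> \<le> exp x"
      using sum_le_suminf[OF summable_exp[of x], of "{..<5}"] that
      by (simp add: exp_def divide_inverse mult.commute)
    finally show ?thesis by (simp add: fact_numeral)
  qed
  have le: "((max (\<bar>z\<bar> - t) 0)\<^sup>2)\<^sup>2 \<le> F z" for z
  proof (cases "\<bar>z\<bar> \<le> t")
    case True
    thus ?thesis by (simp add: F_def)
  next
    case False
    define u where "u = \<bar>z\<bar> - t"
    have u: "u \<ge> 0" using False by (simp add: u_def)
    have "((max (\<bar>z\<bar> - t) 0)\<^sup>2)\<^sup>2 = u ^ 4"
      using u by (simp add: u_def[symmetric])
    also have "\<dots> \<le> (t * u) ^ 4"
      using t u by (intro power_mono) (auto simp: mult_le_cancel_right1)
    also have "\<dots> \<le> 24 * exp (t * u)"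
      using t u by (intro pow4) auto
    also have "t * u = - t\<^sup>2 + t * \<bar>z\<bar>"
      by (simp add: u_def power2_eq_square algebra_simps)
    also have "24 * exp (- t\<^sup>2 + t * \<bar>z\<bar>) = 24 * exp (- t\<^sup>2) * exp (t * \<bar>z\<bar>)"
      by (simp only: exp_add mult.assoc)
    also have "\<dots> \<le> F z"
      unfolding F_def by (intro mult_left_mono) (auto simp: abs_if)
    finally show ?thesis .
  qed
  show int: "integrable std_normal_distribution (\<lambda>z. ((max (\<bar>z\<bar> - t) 0)\<^sup>2)\<^sup>2)"
    by (rule Bochner_Integration.integrable_bound[OF intF]) (use order.trans[OF le abs_ge_self] in \<open>auto intro!: AE_I2\<close>)
  show "(\<integral>z. ((max (\<bar>z\<bar> - t) 0)\<^sup>2)\<^sup>2 \<partial>std_normal_distribution) \<le> 48 * exp (- t\<^sup>2 / 2)"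
    unfolding F[symmetric] by (intro integral_mono int intF le)
qed

text \<open>The excess of \<open>\<bar>x\<bar>\<close> over the level \<open>t\<close>, that is, the soft threshold of \<open>\<bar>x\<bar>\<close>.\<close>
definition excess :: "real \<Rightarrow> real \<Rightarrow> real" where
  "excess t x = max (\<bar>x\<bar> - t) 0"

lemma borel_measurable_excess [measurable]: "excess t \<in> borel_measurable borel"
  unfolding excess_def by measurable

lemma excess_nonneg [simp]: "0 \<le> excess t x"
  by (simp add: excess_def)

text \<open>The sum of the squared excesses, centred under the unshifted law.\<close>
definition excess_statistic :: "nat set \<Rightarrow> real \<Rightarrow> (nat \<Rightarrow> real) \<Rightarrow> real" where
  "excess_statistic I t w
     = (\<Sum>k\<in>I. (excess t (w k))\<^sup>2) - card I * (\<integral>x. (excess t x)\<^sup>2 \<partial>std_normal_distribution)"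

lemma borel_measurable_excess_statistic:
  "excess_statistic I t \<in> borel_measurable (Pi\<^sub>M I (\<lambda>_. borel))"
  unfolding excess_statistic_def by measurable

lemma excess_statistic_deviation:
  assumes I: "finite I" and t: "t \<ge> 1" and a: "a > 0"
  shows "measure (gauss I) {w \<in> space (gauss I). a \<le> \<bar>excess_statistic I t w\<bar>}
    \<le> 48 * card I * exp (- t\<^sup>2 / 2) / a\<^sup>2"
proof -
  have "measure (gauss I) {w \<in> space (gauss I). a \<le> \<bar>(\<Sum>k\<in>I. (excess t (w k))\<^sup>2)
        - (\<Sum>k\<in>I. \<integral>x. (excess t x)\<^sup>2 \<partial>std_normal_distribution)\<bar>}
    \<le> (\<Sum>k\<in>I. \<integral>x. ((excess t x)\<^sup>2)\<^sup>2 \<partial>std_normal_distribution) / a\<^sup>2"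
    using std_normal_excess_moment(1)[OF t] I a
    by (intro gauss_sum_Chebyshev) (auto simp: excess_def)
  also have "\<dots> \<le> (\<Sum>k\<in>I. 48 * exp (- t\<^sup>2 / 2)) / a\<^sup>2"
    using std_normal_excess_moment(2)[OF t] by (intro divide_right_mono sum_mono) (auto simp: excess_def)
  finally show ?thesis by (simp add: excess_statistic_def mult_ac)
qed

text \<open>The triangle inequality, applied to \<open>\<bar>\<mu> k\<bar> \<le> excess t (w k + \<mu> k) + \<bar>w k\<bar> + t\<close>.\<close>
lemma L2_set_excess_ge:
  assumes S: "finite S" and t: "t \<ge> 0"
  shows "L2_set \<mu> S - L2_set w S - t * sqrt (card S) \<le> L2_set (\<lambda>k. excess t (w k + \<mu> k)) S"
proof -
  have "L2_set \<mu> S = L2_set (\<lambda>k. \<bar>\<mu> k\<bar>) S"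
    by (simp add: L2_set_def)
  also have "\<dots> \<le> L2_set (\<lambda>k. excess t (w k + \<mu> k) + (\<bar>w k\<bar> + t)) S"
    by (intro L2_set_mono) (auto simp: excess_def)
  also have "\<dots> \<le> L2_set (\<lambda>k. excess t (w k + \<mu> k)) S + L2_set (\<lambda>k. \<bar>w k\<bar> + t) S"
    by (rule L2_set_triangle_ineq)
  also have "L2_set (\<lambda>k. \<bar>w k\<bar> + t) S \<le> L2_set (\<lambda>k. \<bar>w k\<bar>) S + L2_set (\<lambda>k. t) S"
    by (rule L2_set_triangle_ineq)
  also have "L2_set (\<lambda>k. \<bar>w k\<bar>) S = L2_set w S"
    by (simp add: L2_set_def)
  also have "L2_set (\<lambda>k. t) S = t * sqrt (card S)"
    using t by (simp add: L2_set_constant)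
  finally show ?thesis by simp
qed

text \<open>
  \<open>\<sigma>\<close> is an upper bound of the number of shifted coordinates, and \<open>L\<close> is the logarithm in the
  sparse rate. The threshold \<open>t\<close> is chosen such that \<open>exp (- t\<^sup>2 / 2) = (1 + card I / \<sigma>\<^sup>2)\<^sup>-\<^sup>2\<close>,
  which brings the standard deviation of the statistic down to the order of \<open>\<sigma>\<close>. The critical
  value of the test is \<open>K * \<sigma>\<close>.
\<close>
context
  fixes I :: "nat set" and \<sigma> L t K :: real
  assumes I: "finite I" and \<sigma>: "1 \<le> \<sigma>" "\<sigma> < sqrt (card I)" and K: "K \<ge> 1"
  defines "L \<equiv> ln (1 + card I / \<sigma>\<^sup>2)" and "t \<equiv> 2 * sqrt L"
begin

lemma sigma_sq_le: "\<sigma>\<^sup>2 \<le> card I"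
  using \<sigma> real_le_lsqrt[of "real (card I)" \<sigma>] real_sqrt_le_iff[of "\<sigma>\<^sup>2" "card I"] by simp

lemma log_ratio_ge: "2 / 3 \<le> L"
proof -
  have "1 \<le> card I / \<sigma>\<^sup>2" using sigma_sq_le \<sigma> by simp
  hence "ln 2 \<le> L" unfolding L_def by (subst ln_le_cancel_iff) auto
  thus ?thesis using ln2_ge_two_thirds by linarith
qed

lemma threshold_sq: "t\<^sup>2 = 4 * L"
  using log_ratio_ge by (simp add: t_def power_mult_distrib)

lemma threshold_ge_1: "t \<ge> 1"
  using log_ratio_ge by (intro power2_le_imp_le[of 1 t]) (auto simp: threshold_sq t_def)

lemma excess_statistic_null_deviation:
  "measure (gauss I) {w \<in> space (gauss I). K * \<sigma> \<le> \<bar>excess_statistic I t w\<bar>} \<le> 48 / K\<^sup>2"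
proof -
  define x where "x = card I / \<sigma>\<^sup>2"
  have x: "x \<ge> 1" using sigma_sq_le \<sigma> by (simp add: x_def)
  have "exp L = 1 + x"
    using x by (simp add: L_def x_def[symmetric])
  have "- t\<^sup>2 / 2 = - (2 * L)" by (simp add: threshold_sq)
  hence "exp (- t\<^sup>2 / 2) = 1 / (exp L)\<^sup>2"
    by (simp only: exp_minus exp_double inverse_eq_divide)
  also have "\<dots> = 1 / (1 + x)\<^sup>2"
    using \<open>exp L = 1 + x\<close> by simp
  finally have e: "exp (- t\<^sup>2 / 2) = 1 / (1 + x)\<^sup>2" .
  have "measure (gauss I) {w \<in> space (gauss I). K * \<sigma> \<le> \<bar>excess_statistic I t w\<bar>}
      \<le> 48 * card I * exp (- t\<^sup>2 / 2) / (K * \<sigma>)\<^sup>2"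
    using K \<sigma> by (intro excess_statistic_deviation I threshold_ge_1) auto
  also have "\<dots> = 48 / K\<^sup>2 * (x / (1 + x)\<^sup>2)"
    unfolding e using \<sigma> by (simp add: x_def power_mult_distrib)
  also have "\<dots> \<le> 48 / K\<^sup>2 * 1"
    using x by (intro mult_left_mono) (auto simp: power2_eq_square divide_le_eq algebra_simps)
  finally show ?thesis by simp
qed

lemma excess_statistic_type_I:
  "measure (gauss I) {w \<in> space (gauss I). K * \<sigma> < excess_statistic I t w} \<le> 48 / K\<^sup>2"
proof -
  interpret prob_space "gauss I" by (rule prob_space_gauss)
  have [measurable]: "excess_statistic I t \<in> borel_measurable (gauss I)"
    using borel_measurable_excess_statistic by (simp cong: measurable_cong_sets add: sets_gauss)
  have "prob {w \<in> space (gauss I). K * \<sigma> < excess_statistic I t w}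
      \<le> prob {w \<in> space (gauss I). K * \<sigma> \<le> \<bar>excess_statistic I t w\<bar>}"
    by (intro finite_measure_mono) auto
  also have "\<dots> \<le> 48 / K\<^sup>2" by (rule excess_statistic_null_deviation)
  finally show ?thesis .
qed

text \<open>
  Under a shift by \<open>\<mu>\<close> the statistic differs from its unshifted value only in the terms of the support
  \<open>S\<close> of \<open>\<mu>\<close>, and the unshifted value is under control by the deviation inequality. On \<open>S\<close> the new terms are large by
  the triangle inequality and the old ones are at most the noise on \<open>S\<close>, whose squared norm has mean
  \<open>card S \<le> \<sigma>\<close>. Thus no moment under the alternative is needed.
\<close>
lemma excess_statistic_type_II:
  assumes sparse: "card {k\<in>I. \<mu> k \<noteq> 0} \<le> \<sigma>" and C: "C \<ge> 2 + 4 * sqrt K"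
    and \<mu>: "C\<^sup>2 * (\<sigma> * L) \<le> (\<Sum>k\<in>I. (\<mu> k)\<^sup>2)"
  shows "measure (gauss I) {w \<in> space (gauss I). excess_statistic I t (\<lambda>k\<in>I. w k + \<mu> k) \<le> K * \<sigma>}
    \<le> 48 / K\<^sup>2 + 1 / K"
proof -
  interpret prob_space "gauss I" by (rule prob_space_gauss)
  define S where "S = {k\<in>I. \<mu> k \<noteq> 0}"
  have S: "finite S" "S \<subseteq> I" using I by (auto simp: S_def)
  have [measurable]: "excess_statistic I t \<in> borel_measurable (gauss I)"
    using borel_measurable_excess_statistic by (simp cong: measurable_cong_sets add: sets_gauss)
  \<comment> \<open>The two exceptional events: a large unshifted statistic, or large noise on the support.\<close>
  define A where "A = {w \<in> space (gauss I). K * \<sigma> \<le> \<bar>excess_statistic I t w\<bar>}"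
  define B where "B = {w \<in> space (gauss I). K * \<sigma> \<le> (\<Sum>k\<in>S. (w k)\<^sup>2)}"
  have Sm: "(\<lambda>w. \<Sum>k\<in>S. (w k)\<^sup>2) \<in> borel_measurable (gauss I)"
    using S by (intro borel_measurable_sum borel_measurable_power) auto
  have AB: "A \<in> sets (gauss I)" "B \<in> sets (gauss I)"
    unfolding A_def B_def using Sm by measurable
  have probB: "prob B \<le> 1 / K"
  proof -
    have comp: "integrable (gauss I) (\<lambda>w. (w k)\<^sup>2)" "(\<integral>w. (w k)\<^sup>2 \<partial>gauss I) = 1" if "k \<in> I" for k
      using PiM_integrable_component[of I "\<lambda>_. std_normal_distribution" k "\<lambda>x. x\<^sup>2"] that
        prob_space_std_normal integrable_std_normal_distribution_moment[of 2]
      by (auto simp: std_normal_moments)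
    have int: "integrable (gauss I) (\<lambda>w. \<Sum>k\<in>S. (w k)\<^sup>2)"
      using comp S by (intro Bochner_Integration.integrable_sum) auto
    have "prob B \<le> (\<integral>w. (\<Sum>k\<in>S. (w k)\<^sup>2) \<partial>gauss I) / (K * \<sigma>)"
      unfolding B_def using K \<sigma>
      by (intro integral_Markov_inequality_measure[where A = "{}"] int) (auto intro!: sum_nonneg)
    also have "(\<integral>w. (\<Sum>k\<in>S. (w k)\<^sup>2) \<partial>gauss I) = (\<Sum>k\<in>S. \<integral>w. (w k)\<^sup>2 \<partial>gauss I)"
      using comp S by (intro Bochner_Integration.integral_sum) auto
    also have "\<dots> = card S"
      using comp S by (subst sum.cong[OF refl, of S _ "\<lambda>_. 1"]) auto
    also have "card S / (K * \<sigma>) \<le> \<sigma> / (K * \<sigma>)"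
      using sparse K \<sigma> by (intro divide_right_mono) (auto simp: S_def)
    finally show ?thesis using \<sigma> by simp
  qed
  have "prob {w \<in> space (gauss I). excess_statistic I t (\<lambda>k\<in>I. w k + \<mu> k) \<le> K * \<sigma>} \<le> prob (A \<union> B)"
  proof (intro finite_measure_mono subsetI)
    fix w assume w: "w \<in> {w \<in> space (gauss I). excess_statistic I t (\<lambda>k\<in>I. w k + \<mu> k) \<le> K * \<sigma>}"
    show "w \<in> A \<union> B"
    proof (rule ccontr)
      assume "w \<notin> A \<union> B"
      hence wA: "\<bar>excess_statistic I t w\<bar> < K * \<sigma>" and wB: "(\<Sum>k\<in>S. (w k)\<^sup>2) < K * \<sigma>"
        using w by (auto simp: A_def B_def)
      define q where "q = sqrt (K * \<sigma>)"
      have q: "q > 0" "q\<^sup>2 = K * \<sigma>" using K \<sigma> by (auto simp: q_def)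
      have norm: "C * sqrt (\<sigma> * L) \<le> L2_set \<mu> S"
      proof -
        have "(\<Sum>k\<in>S. (\<mu> k)\<^sup>2) = (\<Sum>k\<in>I. (\<mu> k)\<^sup>2)"
          using S I by (intro sum.mono_neutral_left) (auto simp: S_def)
        hence "sqrt (C\<^sup>2 * (\<sigma> * L)) \<le> L2_set \<mu> S"
          using \<mu> by (simp add: L2_set_def)
        moreover have "C \<ge> 0" using C K by (smt (verit) real_sqrt_ge_zero)
        ultimately show ?thesis by (simp add: real_sqrt_mult)
      qed
      have "L2_set w S \<le> q"
        using wB by (simp add: L2_set_def q_def)
      moreover have "t * sqrt (card S) \<le> 2 * sqrt (\<sigma> * L)"
      proof -
        have "t * sqrt (card S) \<le> t * sqrt \<sigma>"
          using sparse threshold_ge_1 by (intro mult_left_mono) (auto simp: S_def)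
        thus ?thesis by (simp add: t_def real_sqrt_mult mult_ac)
      qed
      ultimately have "(C - 2) * sqrt (\<sigma> * L) - q \<le> L2_set (\<lambda>k. excess t (w k + \<mu> k)) S"
        using norm L2_set_excess_ge[OF S(1), of t \<mu> w] threshold_ge_1 by (simp add: left_diff_distrib)
      moreover have "3 * q \<le> (C - 2) * sqrt (\<sigma> * L)"
      proof -
        have "3 / 4 \<le> sqrt L"
          using log_ratio_ge by (intro real_le_rsqrt) (simp add: power2_eq_square)
        moreover have "2 \<le> C" using C K real_sqrt_ge_zero[of K] by linarith
        ultimately have "4 * sqrt K * (sqrt \<sigma> * (3 / 4)) \<le> (C - 2) * (sqrt \<sigma> * sqrt L)"
          using C \<sigma> by (intro mult_mono mult_left_mono) auto
        thus ?thesis by (simp add: q_def real_sqrt_mult)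
      qed
      ultimately have "2 * q \<le> L2_set (\<lambda>k. excess t (w k + \<mu> k)) S" by linarith
      hence "(2 * q)\<^sup>2 \<le> (L2_set (\<lambda>k. excess t (w k + \<mu> k)) S)\<^sup>2"
        using q by (intro power_mono) auto
      hence big: "4 * (K * \<sigma>) \<le> (\<Sum>k\<in>S. (excess t (w k + \<mu> k))\<^sup>2)"
        by (simp add: L2_set_def sum_nonneg power_mult_distrib q)
      have "(\<Sum>k\<in>S. (excess t (w k))\<^sup>2) \<le> (\<Sum>k\<in>S. (w k)\<^sup>2)"
        using threshold_ge_1 by (intro sum_mono abs_le_square_iff[THEN iffD1]) (auto simp: excess_def)
      hence small: "(\<Sum>k\<in>S. (excess t (w k))\<^sup>2) \<le> K * \<sigma>" using wB by linarith
      \<comment> \<open>Outside the support the shift changes nothing.\<close>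
      have "(\<Sum>k\<in>I. (excess t (w k + \<mu> k))\<^sup>2) - (\<Sum>k\<in>I. (excess t (w k))\<^sup>2)
          = (\<Sum>k\<in>I. (excess t (w k + \<mu> k))\<^sup>2 - (excess t (w k))\<^sup>2)"
        by (simp add: sum_subtractf)
      also have "\<dots> = (\<Sum>k\<in>S. (excess t (w k + \<mu> k))\<^sup>2 - (excess t (w k))\<^sup>2)"
        using S I by (intro sum.mono_neutral_right) (auto simp: S_def)
      finally have "excess_statistic I t (\<lambda>k\<in>I. w k + \<mu> k)
          = excess_statistic I t w + (\<Sum>k\<in>S. (excess t (w k + \<mu> k))\<^sup>2) - (\<Sum>k\<in>S. (excess t (w k))\<^sup>2)"
        by (simp add: excess_statistic_def sum_subtractf)
      moreover have "K * \<sigma> > 0" using K \<sigma> by simp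
      ultimately show False using w wA big small by auto
    qed
  qed (use AB in auto)
  also have "\<dots> \<le> prob A + prob B" using AB by (rule measure_Un_le)
  also have "\<dots> \<le> 48 / K\<^sup>2 + 1 / K"
    using excess_statistic_null_deviation probB unfolding A_def by (rule add_mono)
  finally show ?thesis .
qed

end

section \<open>A uniform prior on sparse group means\<close>

text \<open>
  If \<open>r * m \<le> R\<close>, then \<open>{1..R}\<close> contains \<open>r\<close> consecutive blocks of \<open>m\<close> indices each. The set of
  the indices at position \<open>f i\<close> of block \<open>i\<close>, for \<open>i < r\<close>; blocks and positions are counted from \<open>0\<close>.
\<close>
definition block_support :: "nat \<Rightarrow> nat \<Rightarrow> (nat \<Rightarrow> nat) \<Rightarrow> nat set" where
  "block_support r m f = (\<lambda>i. Suc (i * m + f i)) ` {..<r}"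

text \<open>\<open>a\<close> times the indicator vector of \<open>block_support r m f\<close>.\<close>
definition block_vector :: "nat \<Rightarrow> nat \<Rightarrow> real \<Rightarrow> (nat \<Rightarrow> nat) \<Rightarrow> nat \<Rightarrow> real" where
  "block_vector r m a f k = (if k \<in> block_support r m f then a else 0)"

lemma block_index_inj:
  fixes i i' j j' m :: nat
  assumes "i * m + j = i' * m + j'" "j < m" "j' < m"
  shows "i = i'" "j = j'"
proof -
  have "(i * m + j) div m = i" "(i' * m + j') div m = i'" using assms(2,3) by auto
  thus "i = i'" using assms(1) by simp
  thus "j = j'" using assms(1) by simp
qed

context
  fixes r m R :: nat
  assumes rm: "r * m \<le> R"
begin

lemma block_support_subset:
  assumes f: "f \<in> {..<r} \<rightarrow>\<^sub>E {..<m}"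
  shows "block_support r m f \<subseteq> {1..R}"
proof
  fix k assume "k \<in> block_support r m f"
  then obtain i where i: "i < r" "k = Suc (i * m + f i)" by (auto simp: block_support_def)
  have "f i < m" using f i by auto
  hence "Suc (i * m + f i) \<le> Suc i * m" by simp
  also have "\<dots> \<le> r * m" using i by (intro mult_le_mono1) auto
  finally show "k \<in> {1..R}" using i rm by simp
qed

lemma card_block_support_Int:
  assumes f: "f \<in> {..<r} \<rightarrow>\<^sub>E {..<m}" and g: "g \<in> {..<r} \<rightarrow>\<^sub>E {..<m}"
  shows "card (block_support r m f \<inter> block_support r m g) = card {i\<in>{..<r}. f i = g i}"
proof -
  have b: "f i < m" "g i < m" if "i < r" for i using f g that by auto
  have "block_support r m f \<inter> block_support r m g = (\<lambda>i. Suc (i * m + f i)) ` {i\<in>{..<r}. f i = g i}"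
    (is "?L = ?R")
  proof
    show "?L \<subseteq> ?R"
    proof
      fix k assume "k \<in> ?L"
      then obtain i j where ij: "i < r" "j < r" "k = Suc (i * m + f i)" "k = Suc (j * m + g j)"
        by (auto simp: block_support_def)
      hence "i * m + f i = j * m + g j" by simp
      from block_index_inj[OF this b(1)[OF ij(1)] b(2)[OF ij(2)]]
      show "k \<in> ?R" using ij by auto
    qed
    show "?R \<subseteq> ?L"
    proof
      fix k assume "k \<in> ?R"
      then obtain i where i: "i < r" "f i = g i" "k = Suc (i * m + f i)" by auto
      hence "k = Suc (i * m + g i)" by simp
      with i show "k \<in> ?L" unfolding block_support_def by blast
    qed
  qed
  moreover have "inj_on (\<lambda>i. Suc (i * m + f i)) {i\<in>{..<r}. f i = g i}"
    using b by (intro inj_onI) (auto dest: block_index_inj)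
  ultimately show ?thesis by (simp only: card_image)
qed

lemma card_block_support:
  assumes f: "f \<in> {..<r} \<rightarrow>\<^sub>E {..<m}"
  shows "card (block_support r m f) = r"
  using card_block_support_Int[OF f f] by simp

lemma sum_block_vector_prod:
  assumes f: "f \<in> {..<r} \<rightarrow>\<^sub>E {..<m}" and g: "g \<in> {..<r} \<rightarrow>\<^sub>E {..<m}"
  shows "(\<Sum>k=1..R. block_vector r m a f k * block_vector r m a g k) = a\<^sup>2 * card {i\<in>{..<r}. f i = g i}"
proof -
  have "(\<Sum>k=1..R. block_vector r m a f k * block_vector r m a g k)
      = (\<Sum>k\<in>block_support r m f \<inter> block_support r m g. a\<^sup>2)"
    using block_support_subset[OF f]
    by (intro sum.mono_neutral_cong_right) (auto simp: block_vector_def power2_eq_square)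
  thus ?thesis using card_block_support_Int[OF f g] by simp
qed

text \<open>
  For \<open>f\<close> and \<open>g\<close> drawn independently and uniformly, the inner product of the two vectors is \<open>a\<^sup>2\<close> times the number of blocks where
  \<open>f\<close> and \<open>g\<close> agree, a binomial variable with \<open>r\<close> trials of success probability \<open>1 / m\<close>. With one
  nonzero entry per block the average of the exponential thus factorizes.
\<close>
lemma block_prior_second_moment:
  assumes m: "m > 0"
  shows "(\<Sum>f\<in>{..<r} \<rightarrow>\<^sub>E {..<m}. \<Sum>g\<in>{..<r} \<rightarrow>\<^sub>E {..<m}.
      exp (\<Sum>k=1..R. block_vector r m a f k * block_vector r m a g k))
    = (1 + (exp (a\<^sup>2) - 1) / m) ^ r * (real (card ({..<r} \<rightarrow>\<^sub>E {..<m})))\<^sup>2"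
proof -
  define F where "F = {..<r} \<rightarrow>\<^sub>E {..<m}"
  define q where "q u v = (if u = v then exp (a\<^sup>2) else 1)" for u v :: nat
  have cardF: "real (card F) = real m ^ r" by (simp add: F_def card_PiE)
  have inner: "(\<Sum>g\<in>F. exp (\<Sum>k=1..R. block_vector r m a f k * block_vector r m a g k))
      = (real m + (exp (a\<^sup>2) - 1)) ^ r" if f: "f \<in> F" for f
  proof -
    have "(\<Sum>g\<in>F. exp (\<Sum>k=1..R. block_vector r m a f k * block_vector r m a g k))
        = (\<Sum>g\<in>F. \<Prod>i<r. q (f i) (g i))"
    proof (intro sum.cong refl)
      fix g assume g: "g \<in> F"
      have "exp (\<Sum>k=1..R. block_vector r m a f k * block_vector r m a g k)
          = exp (a\<^sup>2) ^ card {i\<in>{..<r}. f i = g i}"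
        unfolding sum_block_vector_prod[OF f[unfolded F_def] g[unfolded F_def]]
        by (rule exp_of_nat2_mult)
      also have "\<dots> = (\<Prod>i\<in>{i\<in>{..<r}. f i = g i}. exp (a\<^sup>2))" by simp
      also have "\<dots> = (\<Prod>i<r. q (f i) (g i))"
        by (intro prod.mono_neutral_cong_left) (auto simp: q_def)
      finally show "exp (\<Sum>k=1..R. block_vector r m a f k * block_vector r m a g k)
          = (\<Prod>i<r. q (f i) (g i))" .
    qed
    also have "\<dots> = (\<Prod>i<r. \<Sum>j<m. q (f i) j)"
      unfolding F_def by (rule prod_sum_PiE[symmetric]) auto
    also have "\<dots> = (\<Prod>i<r. real m + (exp (a\<^sup>2) - 1))"
    proof (intro prod.cong refl)
      fix i assume "i \<in> {..<r}"
      hence fi: "f i < m" using f by (auto simp: F_def)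
      have "(\<Sum>j<m. q (f i) j) = (\<Sum>j<m. 1 + (if f i = j then exp (a\<^sup>2) - 1 else 0))"
        by (intro sum.cong) (auto simp: q_def)
      also have "\<dots> = real m + (exp (a\<^sup>2) - 1)"
        using fi by (simp add: sum.distrib)
      finally show "(\<Sum>j<m. q (f i) j) = real m + (exp (a\<^sup>2) - 1)" .
    qed
    finally show ?thesis by simp
  qed
  have "(\<Sum>f\<in>F. \<Sum>g\<in>F. exp (\<Sum>k=1..R. block_vector r m a f k * block_vector r m a g k))
      = real (card F) * (real m + (exp (a\<^sup>2) - 1)) ^ r"
    using inner by simp
  also have "real m + (exp (a\<^sup>2) - 1) = real m * (1 + (exp (a\<^sup>2) - 1) / m)"
    using m by (simp add: field_simps)
  also have "real (card F) * (real m * (1 + (exp (a\<^sup>2) - 1) / m)) ^ r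
      = (1 + (exp (a\<^sup>2) - 1) / m) ^ r * (real (card F))\<^sup>2"
    unfolding cardF power_mult_distrib by (simp add: power2_eq_square)
  finally show ?thesis by (simp add: F_def)
qed

end

text \<open>
  The entries \<open>a\<close> solve \<open>exp (a\<^sup>2) = 1 + \<tau> R / r\<^sup>2\<close>. As the \<open>r\<close> blocks have at least \<open>R / (2 r)\<close>
  elements each, the second moment of the likelihood ratio is then at most \<open>exp (2 \<tau>)\<close>.
\<close>
lemma minimax_risk_ge_sparse:
  assumes B: "equal_groups p R B" and R: "R \<in> {1..p}" "R dvd p"
    and r: "1 \<le> r" "r \<le> R" "r * (p div R) \<le> s" and \<delta>: "\<delta> > 0"
    and \<tau>: "\<tau> > 0" "exp (2 * \<tau>) \<le> 1 + \<delta>\<^sup>2" and \<epsilon>: "0 \<le> \<epsilon>"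
    and norm: "\<epsilon>\<^sup>2 \<le> real (p div R) * (real r * ln (1 + \<tau> * (R / (real r)\<^sup>2)))"
  shows "1 - \<delta> \<le> minimax_risk p s 1 R B \<epsilon>"
proof -
  define m where "m = R div r"
  define y where "y = \<tau> * (R / (real r)\<^sup>2)"
  define a where "a = sqrt (ln (1 + y))"
  define F where "F = {..<r} \<rightarrow>\<^sub>E {..<m}"
  have m: "m > 0" using r by (simp add: m_def div_greater_zero_iff)
  have y: "y \<ge> 0" using \<tau> by (simp add: y_def)
  hence a2: "a\<^sup>2 = ln (1 + y)" by (simp add: a_def)
  have rm: "r * m \<le> R" by (simp add: m_def)
  have "R < r * m + r"
    using r mod_less_divisor[of r R] mult_div_mod_eq[of r R] unfolding m_def by linarith
  also have "\<dots> \<le> r * m + r * m" using m by (intro add_mono) auto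
  finally have "real R \<le> real (2 * (r * m))" by (simp only: of_nat_le_iff)
  hence R2: "real R \<le> 2 * real r * real m" by simp
  have "exp (a\<^sup>2) - 1 = y" using y by (simp add: a2)
  hence "real r * ((exp (a\<^sup>2) - 1) / m) = real r * (y / m)" by simp
  also have "\<dots> = \<tau> * (R / (real r * real m))"
    using r by (simp add: y_def power2_eq_square)
  also have "\<dots> \<le> \<tau> * 2"
    using R2 \<tau> r m by (intro mult_left_mono) (auto simp: divide_le_eq mult_ac)
  finally have x: "real r * ((exp (a\<^sup>2) - 1) / m) \<le> 2 * \<tau>" by simp
  have "(1 + (exp (a\<^sup>2) - 1) / m) ^ r \<le> exp ((exp (a\<^sup>2) - 1) / m) ^ r"
    by (intro power_mono) auto
  also have "\<dots> = exp (real r * ((exp (a\<^sup>2) - 1) / m))"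
    by (simp only: exp_of_nat_mult)
  also have "\<dots> \<le> exp (2 * \<tau>)" using x by simp
  also have "\<dots> \<le> 1 + \<delta>\<^sup>2" by (rule \<tau>)
  finally have bound: "(1 + (exp (a\<^sup>2) - 1) / m) ^ r \<le> 1 + \<delta>\<^sup>2" .
  show ?thesis
  proof (rule minimax_risk_ge_of_group_prior[OF B R \<epsilon>])
    show "finite F" by (simp add: F_def finite_PiE)
    show "F \<noteq> {}" using m by (auto simp: F_def PiE_eq_empty_iff)
    show "0 < \<delta>" by (rule \<delta>)
    show "(\<Sum>f\<in>F. \<Sum>g\<in>F. exp (\<Sum>k=1..R. block_vector r m a f k * block_vector r m a g k))
        \<le> (1 + \<delta>\<^sup>2) * (real (card F))\<^sup>2"
      unfolding F_def block_prior_second_moment[OF rm m] using bound by (rule mult_right_mono) simp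
  next
    fix f assume f: "f \<in> F"
    have "card {k\<in>{1..R}. block_vector r m a f k \<noteq> 0} \<le> card (block_support r m f)"
      by (intro card_mono) (auto simp: block_support_def block_vector_def)
    also have "\<dots> = r" using f by (intro card_block_support[OF rm]) (simp add: F_def)
    finally have "card {k\<in>{1..R}. block_vector r m a f k \<noteq> 0} * (p div R) \<le> r * (p div R)"
      by (rule mult_le_mono1)
    thus "card {k\<in>{1..R}. block_vector r m a f k \<noteq> 0} * (p div R) \<le> s" using r(3) by (rule order.trans)
    have "(\<Sum>k=1..R. (block_vector r m a f k)\<^sup>2) = a\<^sup>2 * r"
      using sum_block_vector_prod[OF rm, of f f a] f by (simp add: F_def power2_eq_square)
    thus "\<epsilon>\<^sup>2 \<le> real (p div R) * (\<Sum>k=1..R. (block_vector r m a f k)\<^sup>2)"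
      using norm by (simp add: a2 y_def mult.commute)
  qed
qed

section \<open>The separation rate\<close>

lemma ln_one_plus_scale:
  fixes \<tau> x :: real
  assumes "0 \<le> \<tau>" "\<tau> \<le> 1" "0 \<le> x"
  shows "\<tau> * ln (1 + x) \<le> ln (1 + \<tau> * x)"
  using concave_onD[OF ln_concave, of \<tau> 1 "1 + x"] assms by (simp add: algebra_simps)

context
  fixes p s R :: nat and B :: "nat \<Rightarrow> nat set"
  assumes B: "equal_groups p R B" and R: "R \<in> {1..p}" "R dvd p" and s: "s \<in> {1..p}"
begin

lemma dimension_eq: "real p = real (p div R) * real R"
  using R(2) by (simp only: of_nat_mult[symmetric] dvd_div_mult_self)

lemma real_group_size_pos: "real (p div R) > 0"
  using group_size_pos[OF B R] by simp

lemma number_of_groups_ge_1: "real R \<ge> 1"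
  using R by simp

lemma dense_rate_eq: "real p / sqrt (real R) = real (p div R) * sqrt (real R)"
  unfolding dimension_eq times_divide_eq_right[symmetric] using number_of_groups_ge_1 by (subst real_div_sqrt) auto

text \<open>
  A nonzero group-constant mean has at least \<open>p div R\<close> nonzero coordinates, so with fewer of them every
  alternative is detected without error.
\<close>
lemma minimax_risk_eq_0:
  assumes "real s < real p / real R" and \<epsilon>: "\<epsilon> > 0"
  shows "minimax_risk p s 1 R B \<epsilon> = 0"
proof (rule antisym)
  have sn: "s < p div R"
    using assms(1) number_of_groups_ge_1 unfolding dimension_eq by simp
  have "minimax_risk p s 1 R B \<epsilon> \<le> 0 + 0"
  proof (rule minimax_risk_le_of_group_test[OF B R s, where T = "\<lambda>_. 0" and \<tau> = 0])
    fix \<mu> assume c: "card {k\<in>{1..R}. \<mu> k \<noteq> 0} * (p div R) \<le> s"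
      and n: "\<epsilon>\<^sup>2 \<le> real (p div R) * (\<Sum>k=1..R. (\<mu> k)\<^sup>2)"
    have "card {k\<in>{1..R}. \<mu> k \<noteq> 0} = 0"
    proof (rule ccontr)
      assume "card {k\<in>{1..R}. \<mu> k \<noteq> 0} \<noteq> 0"
      hence "1 \<le> card {k\<in>{1..R}. \<mu> k \<noteq> 0}" by linarith
      hence "1 * (p div R) \<le> card {k\<in>{1..R}. \<mu> k \<noteq> 0} * (p div R)" by (rule mult_le_mono1)
      thus False using c sn by linarith
    qed
    hence "(\<Sum>k=1..R. (\<mu> k)\<^sup>2) = 0" by (intro sum.neutral) auto
    with n have "\<epsilon>\<^sup>2 \<le> 0" by simp
    thus "measure (gauss {1..R}) {w \<in> space (gauss {1..R}). (0 :: real) \<le> 0} \<le> 0" using \<epsilon> by simp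
  qed (use \<epsilon> in auto)
  thus "minimax_risk p s 1 R B \<epsilon> \<le> 0" by simp
  show "0 \<le> minimax_risk p s 1 R B \<epsilon>"
    by (intro minimax_risk_nonneg sparse_alternatives_nonempty s prob_space_obs_law[OF B R])
qed

lemma minimax_risk_le_dense:
  assumes K: "K \<ge> 1" and C: "C \<ge> 4 * K"
  shows "minimax_risk p s 1 R B (C * sqrt (real p / sqrt (real R))) \<le> 3 / K\<^sup>2 + 4 / K\<^sup>2"
proof (rule minimax_risk_le_of_group_test[OF B R s,
      where T = "\<lambda>w. \<Sum>k=1..R. (w k)\<^sup>2" and \<tau> = "real R + K * sqrt (real R)"])
  show "0 \<le> C * sqrt (real p / sqrt (real R))" using C K by simp
  show "(\<lambda>w. \<Sum>k=1..R. (w k)\<^sup>2) \<in> borel_measurable (euclid {1..R})" by measurable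
  show "measure (gauss {1..R}) {w \<in> space (gauss {1..R}). real R + K * sqrt (real R) < (\<Sum>k=1..R. (w k)\<^sup>2)} \<le> 3 / K\<^sup>2"
    using chi_square_type_I[of "{1..R}" K] K R by simp
next
  fix \<mu> assume "(C * sqrt (real p / sqrt (real R)))\<^sup>2 \<le> real (p div R) * (\<Sum>k=1..R. (\<mu> k)\<^sup>2)"
  hence "real (p div R) * (C\<^sup>2 * sqrt (real R)) \<le> real (p div R) * (\<Sum>k=1..R. (\<mu> k)\<^sup>2)"
    unfolding dense_rate_eq by (simp add: power_mult_distrib mult_ac)
  hence "C\<^sup>2 * sqrt (real R) \<le> (\<Sum>k=1..R. (\<mu> k)\<^sup>2)"
    using real_group_size_pos by (simp only: mult_le_cancel_left_pos)
  moreover have "(4 * K)\<^sup>2 * sqrt (real R) \<le> C\<^sup>2 * sqrt (real R)"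
    using C K by (intro mult_right_mono power_mono) auto
  ultimately show "measure (gauss {1..R}) {w \<in> space (gauss {1..R}).
      (\<Sum>k=1..R. ((\<lambda>k\<in>{1..R}. w k + \<mu> k) k)\<^sup>2) \<le> real R + K * sqrt (real R)} \<le> 4 / K\<^sup>2"
    using chi_square_type_II[of "{1..R}" K \<mu>] K R by simp
qed simp

text \<open>In terms of \<open>\<sigma> = s / (p div R)\<close>, the number of groups that \<open>s\<close> coordinates can fill.\<close>
lemma sparse_rate_eq:
  "real s * ln (1 + (real p)\<^sup>2 / (real R * (real s)\<^sup>2))
    = real (p div R) * (real s / real (p div R) * ln (1 + real R / (real s / real (p div R))\<^sup>2))"
proof -
  have "(real p)\<^sup>2 / (real R * (real s)\<^sup>2) = real R / (real s / real (p div R))\<^sup>2"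
    using number_of_groups_ge_1 real_group_size_pos s unfolding dimension_eq by (simp add: power2_eq_square field_simps)
  thus ?thesis using real_group_size_pos by simp
qed

lemma filled_groups:
  shows "real p / real R \<le> real s \<longleftrightarrow> 1 \<le> real s / real (p div R)"
    and "real s < real p / sqrt (real R) \<longleftrightarrow> real s / real (p div R) < sqrt (real R)"
  using real_group_size_pos number_of_groups_ge_1 unfolding dense_rate_eq
  by (simp_all add: dimension_eq pos_le_divide_eq pos_divide_less_eq mult.commute)

lemma minimax_risk_le_sparse:
  assumes lo: "real p / real R \<le> real s" and hi: "real s < real p / sqrt (real R)"
    and K: "K \<ge> 1" and C: "C \<ge> 2 + 4 * sqrt K"
  shows "minimax_risk p s 1 R B (C * sqrt (real s * ln (1 + (real p)\<^sup>2 / (real R * (real s)\<^sup>2))))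
    \<le> 48 / K\<^sup>2 + (48 / K\<^sup>2 + 1 / K)"
proof -
  define \<sigma> where "\<sigma> = real s / real (p div R)"
  define L where "L = ln (1 + card {1..R} / \<sigma>\<^sup>2)"
  define t where "t = 2 * sqrt L"
  have \<sigma>: "1 \<le> \<sigma>" "\<sigma> < sqrt (card {1..R})"
    using lo hi unfolding filled_groups \<sigma>_def by simp_all
  have rate: "real s * ln (1 + (real p)\<^sup>2 / (real R * (real s)\<^sup>2)) = real (p div R) * (\<sigma> * L)"
    unfolding sparse_rate_eq \<sigma>_def L_def by simp
  have L: "L \<ge> 2 / 3" unfolding L_def by (rule log_ratio_ge[OF _ \<sigma> K]) simp
  have C0: "C \<ge> 0" using C K by (smt (verit) real_sqrt_ge_zero)
  show ?thesis
    unfolding rate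
  proof (rule minimax_risk_le_of_group_test[OF B R s,
        where T = "excess_statistic {1..R} t" and \<tau> = "K * \<sigma>"])
    show "0 \<le> C * sqrt (real (p div R) * (\<sigma> * L))" using C0 \<sigma> L by simp
    show "excess_statistic {1..R} t \<in> borel_measurable (euclid {1..R})"
      by (rule borel_measurable_excess_statistic)
    show "measure (gauss {1..R}) {w \<in> space (gauss {1..R}). K * \<sigma> < excess_statistic {1..R} t w} \<le> 48 / K\<^sup>2"
      unfolding t_def L_def by (rule excess_statistic_type_I[OF _ \<sigma> K]) simp
    show "0 \<le> 48 / K\<^sup>2 + 1 / K" using K by simp
  next
    fix \<mu> assume c: "card {k\<in>{1..R}. \<mu> k \<noteq> 0} * (p div R) \<le> s"
      and n: "(C * sqrt (real (p div R) * (\<sigma> * L)))\<^sup>2 \<le> real (p div R) * (\<Sum>k=1..R. (\<mu> k)\<^sup>2)"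
    have "real (card {k\<in>{1..R}. \<mu> k \<noteq> 0}) * real (p div R) \<le> real s"
      using c by (simp only: of_nat_mult[symmetric] of_nat_le_iff)
    hence c': "real (card {k\<in>{1..R}. \<mu> k \<noteq> 0}) \<le> \<sigma>"
      using real_group_size_pos by (simp only: \<sigma>_def pos_le_divide_eq)
    have "real (p div R) * (C\<^sup>2 * (\<sigma> * L)) \<le> real (p div R) * (\<Sum>k=1..R. (\<mu> k)\<^sup>2)"
      using n \<sigma> L by (simp add: power_mult_distrib mult_ac)
    hence "C\<^sup>2 * (\<sigma> * L) \<le> (\<Sum>k=1..R. (\<mu> k)\<^sup>2)"
      using real_group_size_pos by (simp only: mult_le_cancel_left_pos)
    thus "measure (gauss {1..R}) {w \<in> space (gauss {1..R}).
        excess_statistic {1..R} t (\<lambda>k\<in>{1..R}. w k + \<mu> k) \<le> K * \<sigma>} \<le> 48 / K\<^sup>2 + 1 / K"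
      unfolding t_def L_def by (intro excess_statistic_type_II[OF _ \<sigma> K c' C]) simp_all
  qed
qed

text \<open>
  Both nondegenerate rates are of the order of \<open>n \<rho> ln (1 + R / \<rho>\<^sup>2)\<close>, where \<open>n = p div R\<close> and \<open>\<rho>\<close> is
  the minimum of \<open>s / n\<close> and \<open>\<surd>R\<close>; the prior is supported on \<open>\<lfloor>\<rho>\<rfloor>\<close> groups.
\<close>
lemma minimax_risk_ge_rate:
  assumes \<tau>: "0 < \<tau>" "\<tau> \<le> 1" "exp (2 * \<tau>) \<le> 1 + \<delta>\<^sup>2" and \<delta>: "\<delta> > 0" and \<epsilon>: "0 \<le> \<epsilon>"
    and lo: "real p / real R \<le> real s"
    and rate: "\<epsilon>\<^sup>2 \<le> \<tau> / 4 * (if real s < real p / sqrt (real R)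
         then real s * ln (1 + (real p)\<^sup>2 / (real R * (real s)\<^sup>2))
         else real p / sqrt (real R))"
  shows "1 - \<delta> \<le> minimax_risk p s 1 R B \<epsilon>"
proof -
  define n where "n = real (p div R)"
  have n: "n > 0" using real_group_size_pos by (simp add: n_def)
  define \<sigma> where "\<sigma> = real s / n"
  define \<rho> where "\<rho> = min \<sigma> (sqrt (real R))"
  define r where "r = nat \<lfloor>\<rho>\<rfloor>"
  have \<sigma>1: "1 \<le> \<sigma>" using lo unfolding filled_groups \<sigma>_def n_def .
  have \<rho>1: "1 \<le> \<rho>" using \<sigma>1 number_of_groups_ge_1 by (simp add: \<rho>_def)
  have r: "1 \<le> r" "real r \<le> \<rho>" "\<rho> \<le> 2 * real r"
  proof -
    have "1 \<le> \<lfloor>\<rho>\<rfloor>" using \<rho>1 by simp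
    moreover from this have "real r = of_int \<lfloor>\<rho>\<rfloor>" by (simp add: r_def)
    moreover from calculation have "1 \<le> r" by linarith
    ultimately show "1 \<le> r" "real r \<le> \<rho>" "\<rho> \<le> 2 * real r" by linarith+
  qed
  have r\<sigma>: "real r \<le> \<sigma>" and rR: "real r \<le> sqrt (real R)"
    using r by (auto simp: \<rho>_def)
  have "sqrt (real R) \<le> real R"
    using number_of_groups_ge_1 by (intro real_le_lsqrt) (auto simp: power2_eq_square)
  hence r_R: "r \<le> R" using rR by linarith
  have "real r * n \<le> real s"
    using r\<sigma> n by (simp add: \<sigma>_def pos_le_divide_eq)
  hence r_s: "r * (p div R) \<le> s"
    unfolding n_def by (simp only: of_nat_mult[symmetric] of_nat_le_iff)
  define G where "G = ln (1 + real R / \<rho>\<^sup>2)"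
  have "\<rho>\<^sup>2 \<le> real R"
    using power_mono[of \<rho> "sqrt (real R)" 2] \<rho>1 by (simp add: \<rho>_def)
  hence "1 \<le> real R / \<rho>\<^sup>2" using \<rho>1 by simp
  hence "ln 2 \<le> G" unfolding G_def by (subst ln_le_cancel_iff) auto
  hence G: "2 / 3 \<le> G" using ln2_ge_two_thirds by linarith
  have Glow: "\<tau> * G \<le> ln (1 + \<tau> * (real R / (real r)\<^sup>2))"
  proof -
    have "\<tau> * G \<le> ln (1 + \<tau> * (real R / \<rho>\<^sup>2))"
      unfolding G_def using \<tau> by (intro ln_one_plus_scale) auto
    also have "\<dots> \<le> ln (1 + \<tau> * (real R / (real r)\<^sup>2))"
    proof (subst ln_le_cancel_iff)
      have "real R / \<rho>\<^sup>2 \<le> real R / (real r)\<^sup>2"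
        using r \<rho>1 by (intro divide_left_mono power_mono) auto
      thus "1 + \<tau> * (real R / \<rho>\<^sup>2) \<le> 1 + \<tau> * (real R / (real r)\<^sup>2)"
        using \<tau> by (intro add_left_mono mult_left_mono) auto
    qed (use \<tau> in \<open>auto intro!: add_pos_nonneg\<close>)
    finally show ?thesis .
  qed
  have main: "n * (\<rho> / 2 * (\<tau> * G)) \<le> n * (real r * ln (1 + \<tau> * (real R / (real r)\<^sup>2)))"
    using n r Glow \<tau> G by (intro mult_left_mono mult_mono) auto
  have "(if real s < real p / sqrt (real R)
         then real s * ln (1 + (real p)\<^sup>2 / (real R * (real s)\<^sup>2))
         else real p / sqrt (real R)) \<le> 2 * (n * (\<rho> * G))"
  proof (cases "real s < real p / sqrt (real R)")
    case True
    hence "\<rho> = \<sigma>" unfolding filled_groups by (simp add: \<rho>_def \<sigma>_def n_def)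
    hence "real s * ln (1 + (real p)\<^sup>2 / (real R * (real s)\<^sup>2)) = n * (\<rho> * G)"
      unfolding sparse_rate_eq by (simp add: G_def \<sigma>_def n_def)
    thus ?thesis using True n \<rho>1 G by simp
  next
    case False
    hence "\<rho> = sqrt (real R)" unfolding filled_groups by (simp add: \<rho>_def \<sigma>_def n_def)
    hence "real p / sqrt (real R) = n * (\<rho> * 1)"
      unfolding dense_rate_eq by (simp add: n_def)
    also have "\<dots> \<le> n * (\<rho> * (2 * G))"
      using n \<rho>1 G by (intro mult_left_mono) auto
    finally show ?thesis using False by simp
  qed
  with rate have "\<epsilon>\<^sup>2 \<le> \<tau> / 4 * (2 * (n * (\<rho> * G)))"
    using \<tau> by (elim order.trans) (intro mult_left_mono, auto)
  also have "\<dots> = n * (\<rho> / 2 * (\<tau> * G))" by simp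
  also note main
  finally have norm: "\<epsilon>\<^sup>2 \<le> n * (real r * ln (1 + \<tau> * (real R / (real r)\<^sup>2)))" .
  show ?thesis
    by (rule minimax_risk_ge_sparse[OF B R r(1) r_R r_s \<delta> \<tau>(1,3) \<epsilon> norm[unfolded n_def]])
qed

end

theorem theorem7:
  shows "minimax_separation_rate
    {(p, s, \<gamma>, R). s \<in> {1..p} \<and> R \<in> {1..p} \<and> R dvd p \<and> \<gamma> = 1}
    (\<lambda>p s \<gamma> R. sqrt (
       if real s < real p / real R then 0
       else if real s < real p / sqrt (real R)
         then real s * ln (1 + (real p)\<^sup>2 / (real R * (real s)\<^sup>2))
       else real p / sqrt (real R)))"
proof -
  define q where "q p s R = (if real s < real p / real R then 0
       else if real s < real p / sqrt (real R)
         then real s * ln (1 + (real p)\<^sup>2 / (real R * (real s)\<^sup>2))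
       else real p / sqrt (real R))" for p s R :: nat
  define A :: "(nat \<times> nat \<times> real \<times> nat) set" where "A = {(p, s, \<gamma>, R). s \<in> {1..p} \<and> R \<in> {1..p} \<and> R dvd p \<and> \<gamma> = (1 :: real)}"
  have A: "s \<in> {1..p}" "R \<in> {1..p}" "R dvd p" "\<gamma> = 1" if "(p, s, \<gamma>, R) \<in> A" for p s R :: nat and \<gamma> :: real
    using that by (auto simp: A_def)
  have q_pos: "0 \<le> q p s R" "q p s R = 0 \<longleftrightarrow> real s < real p / real R" if "(p, s, \<gamma>, R) \<in> A" for p s R :: nat and \<gamma> :: real
  proof -
    have p: "real p > 0" "real R > 0" "real s > 0" using A[OF that] by auto
    have "0 < ln (1 + (real p)\<^sup>2 / (real R * (real s)\<^sup>2))"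
      using p by (intro ln_gt_zero) (simp only: less_add_same_cancel1, simp)
    thus "0 \<le> q p s R" "q p s R = 0 \<longleftrightarrow> real s < real p / real R"
      using p by (auto simp: q_def)
  qed
  have "minimax_separation_rate A (\<lambda>p s \<gamma> R. sqrt (q p s R))"
    unfolding minimax_separation_rate_def
  proof (intro conjI ballI, safe)
    fix p s R :: nat and \<gamma> :: real assume "(p, s, \<gamma>, R) \<in> A"
    thus "0 \<le> sqrt (q p s R)" by (simp add: q_pos)
  next
    fix p s R :: nat and \<gamma> \<epsilon> :: real and B
    assume a: "(p, s, \<gamma>, R) \<in> A" and B: "equal_groups p R B" and "sqrt (q p s R) = 0" and \<epsilon>: "0 < \<epsilon>"
    hence "real s < real p / real R" using q_pos[OF a] by simp
    thus "minimax_risk p s \<gamma> R B \<epsilon> = 0"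
      using minimax_risk_eq_0[OF B A(2,3,1)[OF a]] \<epsilon> A(4)[OF a] by simp
  next
    fix \<eta> :: real assume \<eta>: "\<eta> \<in> {0<..<1}"
    \<comment> \<open>With this \<open>K\<close> the error bounds \<open>96 / K\<^sup>2 + 1 / K\<close> and \<open>7 / K\<^sup>2\<close> are below \<open>\<eta>\<close>.\<close>
    define K where "K = 100 / \<eta>"
    have K: "K \<ge> 100" using \<eta> by (simp add: K_def pos_le_divide_eq)
    hence "sqrt K \<le> K" by (intro real_le_lsqrt) (auto simp: power2_eq_square)
    have K2: "100 / K\<^sup>2 \<le> 1 / K"
      using K by (simp add: power2_eq_square divide_simps)
    have K\<eta>: "1 / K \<le> \<eta> / 100" using \<eta> by (simp add: K_def)
    show "\<exists>C\<^sub>\<eta>>0. \<forall>C>C\<^sub>\<eta>. \<forall>(p, s, \<gamma>, R)\<in>A. \<forall>B. equal_groups p R B \<longrightarrow> 0 < sqrt (q p s R) \<longrightarrow>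
        minimax_risk p s \<gamma> R B (C * sqrt (q p s R)) \<le> \<eta>"
    proof (intro exI[of _ "2 + 4 * K"] conjI allI impI ballI, goal_cases)
      case 1 thus ?case using K by simp
    next
      case (2 C x)
      obtain p s \<gamma> R where x: "x = (p, s, \<gamma>, R)" by (cases x)
      have a: "(p, s, \<gamma>, R) \<in> A" using 2 x by simp
      show ?case
        unfolding x prod.case
      proof (intro allI impI)
        fix B assume B: "equal_groups p R B" and "0 < sqrt (q p s R)"
        hence lo: "real p / real R \<le> real s" using q_pos[OF a] by auto
        show "minimax_risk p s \<gamma> R B (C * sqrt (q p s R)) \<le> \<eta>"
        proof (cases "real s < real p / sqrt (real R)")
          case True
          hence "minimax_risk p s \<gamma> R B (C * sqrt (q p s R)) \<le> 48 / K\<^sup>2 + (48 / K\<^sup>2 + 1 / K)"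
            using minimax_risk_le_sparse[OF B A(2,3,1)[OF a] lo True, of K C] lo 2 K \<open>sqrt K \<le> K\<close> A(4)[OF a]
            by (simp add: q_def)
          also have "\<dots> \<le> \<eta>" using K2 K\<eta> \<eta> by (simp add: field_simps)
          finally show ?thesis .
        next
          case False
          hence "minimax_risk p s \<gamma> R B (C * sqrt (q p s R)) \<le> 3 / K\<^sup>2 + 4 / K\<^sup>2"
            using minimax_risk_le_dense[OF B A(2,3,1)[OF a], of K C] lo 2 K A(4)[OF a]
            by (simp add: q_def)
          also have "\<dots> \<le> \<eta>" using K2 K\<eta> \<eta> by (simp add: field_simps)
          finally show ?thesis .
        qed
      qed
    qed
  next
    fix \<eta> :: real assume \<eta>: "\<eta> \<in> {0<..<1}"
    \<comment> \<open>The largest scale that keeps the second moment of the likelihood ratio below \<open>1 + \<eta>\<^sup>2\<close>.\<close>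
    define \<tau> where "\<tau> = ln (1 + \<eta>\<^sup>2) / 2"
    have \<eta>2: "0 < \<eta>\<^sup>2" "\<eta>\<^sup>2 \<le> 1" using \<eta> by (auto simp: power_le_one)
    have "ln (1 + \<eta>\<^sup>2) \<le> \<eta>\<^sup>2" by (rule ln_add_one_self_le_self) simp
    moreover have "0 < ln (1 + \<eta>\<^sup>2)" using \<eta>2 by (intro ln_gt_zero) simp
    ultimately have \<tau>: "0 < \<tau>" "\<tau> \<le> 1" using \<eta>2 unfolding \<tau>_def by linarith+
    have "2 * \<tau> = ln (1 + \<eta>\<^sup>2)" by (simp add: \<tau>_def)
    moreover have "0 < 1 + \<eta>\<^sup>2" using \<eta>2(1) by linarith
    ultimately have exp\<tau>: "exp (2 * \<tau>) \<le> 1 + \<eta>\<^sup>2" by (simp only: exp_ln)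
    show "\<exists>c\<^sub>\<eta>>0. \<forall>c. 0 < c \<and> c < c\<^sub>\<eta> \<longrightarrow> (\<forall>(p, s, \<gamma>, R)\<in>A. \<forall>B. equal_groups p R B \<longrightarrow> 0 < sqrt (q p s R) \<longrightarrow>
        1 - \<eta> \<le> minimax_risk p s \<gamma> R B (c * sqrt (q p s R)))"
    proof (intro exI[of _ "sqrt (\<tau> / 4)"] conjI allI impI ballI, goal_cases)
      case 1 thus ?case using \<tau> by simp
    next
      case (2 c x)
      obtain p s \<gamma> R where x: "x = (p, s, \<gamma>, R)" by (cases x)
      have a: "(p, s, \<gamma>, R) \<in> A" using 2 x by simp
      have "c\<^sup>2 \<le> (sqrt (\<tau> / 4))\<^sup>2" using 2 by (intro power_mono) auto
      hence c2: "c\<^sup>2 \<le> \<tau> / 4" using \<tau> by simp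
      show ?case
        unfolding x prod.case
      proof (intro allI impI)
        fix B assume B: "equal_groups p R B" and "0 < sqrt (q p s R)"
        hence lo: "real p / real R \<le> real s" using q_pos[OF a] by auto
        have "1 - \<eta> \<le> minimax_risk p s 1 R B (c * sqrt (q p s R))"
        proof (rule minimax_risk_ge_rate[OF B A(2,3,1)[OF a] \<tau> exp\<tau> _ _ lo])
          show "0 < \<eta>" using \<eta> by simp
          show "0 \<le> c * sqrt (q p s R)" using 2 q_pos(1)[OF a] by simp
          have "(c * sqrt (q p s R))\<^sup>2 = c\<^sup>2 * q p s R"
            using q_pos(1)[OF a] by (simp add: power_mult_distrib)
          also have "\<dots> \<le> \<tau> / 4 * q p s R"
            using c2 q_pos(1)[OF a] by (rule mult_right_mono)
          finally show "(c * sqrt (q p s R))\<^sup>2 \<le> \<tau> / 4 * (if real s < real p / sqrt (real R)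
             then real s * ln (1 + (real p)\<^sup>2 / (real R * (real s)\<^sup>2))
             else real p / sqrt (real R))"
            using lo by (simp add: q_def)
        qed
        thus "1 - \<eta> \<le> minimax_risk p s \<gamma> R B (c * sqrt (q p s R))"
          using A(4)[OF a] by simp
      qed
    qed
  qed
  thus ?thesis unfolding A_def q_def .
qed

end
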